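(* Let $d\in\mathbb N$ and $p>\frac{2(d+4)}{d}$. For every $\varepsilon>0$ there is a constant $C_\varepsilon$ (depending on $\varepsilon,p,d$ but not on $N$) such that for all $N\in\mathbb N$, $$K_{p,d,N}\le C_\varepsilon N^{\frac d2-\frac{d+2}{p}+\varepsilon}.$$
   Context: $\mathbb T=\mathbb R/\mathbb Z$ with normalized Lebesgue measure. $S_{d,N}=\{(n_1,\dots,n_d)\in\mathbb Z^d:|n_j|\le N,\ 1\le j\le d\}$ and $|\mathbf n|^2=n_1^2+\cdots+n_d^2$. $K_{p,d,N}$ is the best (smallest) constant such that for all complex numbers $\{a_{\mathbf n}\}_{\mathbf n\in S_{d,N}}$, $$\left\|\sum_{\mathbf n\in S_{d,N}}a_{\mathbf n}e^{2\pi i(\mathbf n\cdot\mathbf x+|\mathbf n|^2t)}\right\|_{L^p(\mathbb T^{d+1})}\le K_{p,d,N}\left(\sum_{\mathbf n}|a_{\mathbf n}|^2\right)^{1/2}.$$ *)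

theory Defs
  imports "HOL-Probability.Probability"
begin

text \<open>
  Functions on \<open>\<real>/\<int>\<close> are represented on the fundamental domain \<open>[0,1)\<close>, which carries
  total mass 1.
\<close>

definition torus :: "real measure" where
  "torus = restrict_space lborel {0..<1}"

text \<open>
  The space-time torus of dimension \<open>d + 1\<close>.  A point is a pair \<open>(x, t)\<close>, with
  \<open>x 0, \<dots>, x (d - 1)\<close> the space coordinates; the coordinates, and those of frequencies below,
  are numbered from 0.
\<close>

definition torus_st :: "nat \<Rightarrow> ((nat \<Rightarrow> real) \<times> real) measure" where
  "torus_st d = (\<Pi>\<^sub>M j\<in>{..<d}. torus) \<Otimes>\<^sub>M torus"

definition Lp_norm :: "'a measure \<Rightarrow> real \<Rightarrow> ('a \<Rightarrow> complex) \<Rightarrow> real" where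
  "Lp_norm M p f = (\<integral>z. norm (f z) powr p \<partial>M) powr (1 / p)"

definition freqs :: "nat \<Rightarrow> nat \<Rightarrow> (nat \<Rightarrow> int) set" where
  "freqs d N = (\<Pi>\<^sub>E j\<in>{..<d}. {n. \<bar>n\<bar> \<le> int N})"

definition schroedinger_sum ::
    "nat \<Rightarrow> nat \<Rightarrow> ((nat \<Rightarrow> int) \<Rightarrow> complex) \<Rightarrow> (nat \<Rightarrow> real) \<times> real \<Rightarrow> complex" where
  "schroedinger_sum d N a = (\<lambda>(x, t). \<Sum>n\<in>freqs d N.
     a n * exp (2 * of_real pi * \<i> *
       of_real ((\<Sum>j<d. real_of_int (n j) * x j) + (\<Sum>j<d. (real_of_int (n j))\<^sup>2) * t)))"

definition l2_norm :: "nat \<Rightarrow> nat \<Rightarrow> ((nat \<Rightarrow> int) \<Rightarrow> complex) \<Rightarrow> real" where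
  "l2_norm d N a = sqrt (\<Sum>n\<in>freqs d N. (norm (a n))\<^sup>2)"

text \<open>
  For \<open>p > 0\<close> the infimum is attained; see \<open>strichartz_const_bound\<close> and
  \<open>strichartz_const_least\<close>.
\<close>

definition strichartz_const :: "real \<Rightarrow> nat \<Rightarrow> nat \<Rightarrow> real" where
  "strichartz_const p d N =
     Inf {K. \<forall>a. Lp_norm (torus_st d) p (schroedinger_sum d N a) \<le> K * l2_norm d N a}"

lemma prob_space_torus: "prob_space torus"
  by (rule prob_spaceI) (simp add: torus_def space_restrict_space emeasure_restrict_space)

lemma prob_space_torus_st: "prob_space (torus_st d)"
proof -
  interpret T: prob_space torus by (rule prob_space_torus)
  interpret P: product_prob_space "\<lambda>_. torus" "{..<d}" by unfold_locales
  interpret Q: pair_prob_space "\<Pi>\<^sub>M j\<in>{..<d}. torus" torus by unfold_locales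
  show ?thesis unfolding torus_st_def by unfold_locales
qed

lemma finite_freqs: "finite (freqs d N)"
proof -
  have "{n. \<bar>n\<bar> \<le> int N} = {- int N..int N}" by auto
  then show ?thesis by (auto simp: freqs_def intro!: finite_PiE)
qed

lemma freqs_nonempty: "freqs d N \<noteq> {}"
proof -
  have "(\<lambda>j\<in>{..<d}. 0) \<in> freqs d N" by (auto simp: freqs_def)
  then show ?thesis by blast
qed

lemma schroedinger_sum_measurable [measurable]:
  "schroedinger_sum d N a \<in> borel_measurable (torus_st d)"
proof -
  have [measurable]: "(\<lambda>x. x) \<in> borel_measurable torus"
    unfolding torus_def by (intro measurable_restrict_space1) simp
  have [measurable]: "(\<lambda>z. snd z) \<in> borel_measurable (torus_st d)"
    unfolding torus_st_def by measurable
  have [measurable]: "(\<lambda>z. fst z j) \<in> borel_measurable (torus_st d)" if "j < d" for j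
  proof -
    have "(\<lambda>x. x j) \<in> measurable (\<Pi>\<^sub>M j\<in>{..<d}. torus) torus"
      using that by (intro measurable_component_singleton) auto
    then show ?thesis
      unfolding torus_st_def by measurable
  qed
  have "(\<lambda>z. \<Sum>j<d. real_of_int (n j) * fst z j) \<in> borel_measurable (torus_st d)" for n :: "nat \<Rightarrow> int"
    by (intro borel_measurable_sum borel_measurable_times) auto
  note [measurable] = this
  show ?thesis
    unfolding schroedinger_sum_def case_prod_unfold
    by measurable
qed

lemma norm_schroedinger_sum_le: "norm (schroedinger_sum d N a z) \<le> (\<Sum>n\<in>freqs d N. norm (a n))"
proof -
  obtain x t where z: "z = (x, t)" by (cases z)
  have "norm (a n * exp (2 * of_real pi * \<i> *
       of_real ((\<Sum>j<d. real_of_int (n j) * x j) + (\<Sum>j<d. (real_of_int (n j))\<^sup>2) * t))) = norm (a n)"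
    for n :: "nat \<Rightarrow> int"
    by (simp add: norm_mult)
  then show ?thesis
    unfolding schroedinger_sum_def z by (auto intro!: sum_norm_le)
qed

lemma integrable_schroedinger_sum:
  assumes "p > 0"
  shows "integrable (torus_st d) (\<lambda>z. norm (schroedinger_sum d N a z) powr p)"
proof -
  interpret prob_space "torus_st d" by (rule prob_space_torus_st)
  show ?thesis
    by (rule integrable_const_bound[where B = "(\<Sum>n\<in>freqs d N. norm (a n)) powr p"])
      (use assms in \<open>auto intro!: powr_mono2 norm_schroedinger_sum_le\<close>)
qed

lemma Lp_norm_schroedinger_sum_le:
  assumes "p > 0"
  shows "Lp_norm (torus_st d) p (schroedinger_sum d N a) \<le> (\<Sum>n\<in>freqs d N. norm (a n))"
proof -
  interpret prob_space "torus_st d" by (rule prob_space_torus_st)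
  let ?B = "\<Sum>n\<in>freqs d N. norm (a n)"
  have "(\<integral>z. norm (schroedinger_sum d N a z) powr p \<partial>torus_st d) \<le> ?B powr p"
    by (rule integral_le_const[OF integrable_schroedinger_sum])
      (use assms in \<open>auto intro!: powr_mono2 norm_schroedinger_sum_le\<close>)
  then have "Lp_norm (torus_st d) p (schroedinger_sum d N a) \<le> (?B powr p) powr (1 / p)"
    unfolding Lp_norm_def using assms by (intro powr_mono2) auto
  also have "\<dots> = ?B" using assms by (simp add: powr_powr sum_nonneg)
  finally show ?thesis .
qed

lemma norm_le_l2_norm:
  assumes "n \<in> freqs d N" shows "norm (a n) \<le> l2_norm d N a"
  unfolding l2_norm_def
  by (rule real_le_rsqrt, rule member_le_sum[OF assms]) (auto simp: finite_freqs)

lemma strichartz_admissible_nonneg: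
  assumes "\<forall>a. Lp_norm (torus_st d) p (schroedinger_sum d N a) \<le> K * l2_norm d N a"
  shows "0 \<le> K"
proof -
  obtain m where m: "m \<in> freqs d N" using freqs_nonempty by blast
  have "0 < l2_norm d N (\<lambda>_. 1)"
    using norm_le_l2_norm[OF m, of "\<lambda>_. 1"] by simp
  moreover have "0 \<le> K * l2_norm d N (\<lambda>_. 1)"
    by (rule order_trans[OF _ assms[rule_format]]) (simp add: Lp_norm_def)
  ultimately show ?thesis by (simp add: zero_le_mult_iff)
qed

lemma strichartz_const_least:
  assumes "\<forall>a. Lp_norm (torus_st d) p (schroedinger_sum d N a) \<le> K * l2_norm d N a"
  shows "strichartz_const p d N \<le> K"
  unfolding strichartz_const_def
  by (rule cInf_lower) (use assms strichartz_admissible_nonneg in \<open>auto intro!: bdd_belowI[of _ 0]\<close>)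

lemma strichartz_const_bound:
  assumes "p > 0"
  shows "Lp_norm (torus_st d) p (schroedinger_sum d N a) \<le> strichartz_const p d N * l2_norm d N a"
proof -
  let ?A = "{K. \<forall>a. Lp_norm (torus_st d) p (schroedinger_sum d N a) \<le> K * l2_norm d N a}"
  have "Lp_norm (torus_st d) p (schroedinger_sum d N a) \<le> card (freqs d N) * l2_norm d N a" for a
  proof -
    have "(\<Sum>n\<in>freqs d N. norm (a n)) \<le> card (freqs d N) * l2_norm d N a"
      by (rule sum_bounded_above) (rule norm_le_l2_norm)
    then show ?thesis using Lp_norm_schroedinger_sum_le[OF assms, of d N a] by linarith
  qed
  then have ne: "real (card (freqs d N)) \<in> ?A" by blast
  have "0 \<le> l2_norm d N a" by (simp add: l2_norm_def sum_nonneg)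
  then consider "l2_norm d N a = 0" | "0 < l2_norm d N a" by linarith
  then show ?thesis
  proof cases
    case 1
    have "Lp_norm (torus_st d) p (schroedinger_sum d N a) \<le> card (freqs d N) * l2_norm d N a"
      using ne by blast
    with 1 show ?thesis by simp
  next
    case 2
    have "Lp_norm (torus_st d) p (schroedinger_sum d N a) / l2_norm d N a \<le> Inf ?A"
      by (rule cInf_greatest) (use ne 2 in \<open>auto simp: pos_divide_le_eq\<close>)
    with 2 show ?thesis by (simp add: strichartz_const_def pos_divide_le_eq)
  qed
qed

end

theory Submission
  imports Defs "HOL-Real_Asymp.Real_Asymp"
begin

text \<open>
  Normalise the coefficients \<open>a\<close> in \<open>l\<^sup>2\<close>, let \<open>F\<close> be the exponential sum, \<open>E\<close> the set where
  \<open>\<bar>F\<bar> > \<alpha>\<close>, and \<open>f\<close> the phase of \<open>F\<close> restricted to \<open>E\<close>.  By duality \<open>\<alpha>\<^sup>2 \<bar>E\<bar>\<^sup>2\<close> is at most the sum of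
  the squared Fourier coefficients of \<open>f\<close> over the paraboloid, that is, \<open>\<langle>K * f, f\<rangle>\<close> with the Weyl kernel
  \<open>K\<close>.  Following Hu and Li, multiply \<open>K\<close> by a trigonometric polynomial \<open>\<Phi>\<close> in \<open>t\<close> of mean 1 that is
  concentrated near the fractions whose denominators are primes of size about \<open>Q\<close>, where
  \<open>N \<le> Q \<le> N\<^sup>2\<close>.  Up to factors \<open>N\<^bsup>\<epsilon>\<^esup>\<close>, Weyl's inequality bounds \<open>K \<Phi>\<close> by \<open>Q\<^bsup>d/2\<^esup>\<close>, and the nonconstant
  Fourier coefficients of \<open>\<Phi>\<close> are at most \<open>1 / Q\<close>, so that Bessel's inequality gives
  \<open>\<alpha>\<^sup>2 \<bar>E\<bar>\<^sup>2 \<le> Q\<^bsup>d/2\<^esup> \<bar>E\<bar>\<^sup>2 + \<bar>E\<bar> / Q\<close>.  Taking \<open>\<alpha>\<^sup>2 = 2 Q\<^bsup>d/2\<^esup>\<close> yields \<open>\<bar>E\<bar> \<le> 2 / (Q \<alpha>\<^sup>2)\<close> for all levels \<open>\<alpha>\<close> between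
  \<open>N\<^bsup>d/4\<^esup>\<close> and the trivial bound \<open>N\<^bsup>d/2\<^esup>\<close>.  The values below \<open>N\<^bsup>d/4\<^esup>\<close> are controlled by the \<open>L\<^sup>2\<close> norm alone; this
  is where \<open>p > 2 (d + 4) / d\<close> enters.
\<close>

section \<open>A lower bound for the number of primes\<close>

lemma mult_binomial_dvd_Lcm:
  assumes "k \<le> n"
  shows "Suc n * (n choose k) dvd Lcm {1..Suc n}"
  using assms
proof (induction k arbitrary: n)
  case 0
  show ?case by (auto intro!: dvd_Lcm)
next
  case (Suc k)
  then obtain m where n: "n = Suc m" and km: "k \<le> m" by (cases n) auto
  let ?f = "\<lambda>n k. Suc n * (n choose k)"
  have "?f m k dvd Lcm {1..Suc m}" using Suc.IH km .
  also have "Lcm {1..Suc m} dvd Lcm {1..Suc n}" unfolding n by (intro Lcm_subset) auto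
  finally obtain x where x: "Lcm {1..Suc n} = ?f m k * x" by (elim dvdE)
  have "?f n k dvd Lcm {1..Suc n}" by (rule Suc.IH) (use km n in simp)
  then obtain y where y: "Lcm {1..Suc n} = ?f n k * y" by (elim dvdE)
  \<comment> \<open>The numbers \<open>1 / ((n + 1) (n choose k))\<close> form Leibniz's harmonic triangle, so each is the difference of two
    numbers whose denominators are already known to divide the least common multiple.\<close>
  define L where "L = real (Lcm {1..Suc n})"
  have e1: "real (Suc k) * real (n choose Suc k) = real n * real (m choose k)"
    using Suc_times_binomial_eq[of m k] unfolding n by (metis mult.commute of_nat_mult)
  have e2: "real (n - k) * real (n choose k) = real n * real (m choose k)"
    using binomial_absorb_comp[of n k] unfolding n by (metis diff_Suc_1 of_nat_mult)
  have pos: "real (n choose k) > 0" "real (m choose k) > 0" "real (n choose Suc k) > 0"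
    using Suc.prems km n by (simp_all only: of_nat_0_less_iff zero_less_binomial_iff)
  define c where "c = real n * real (m choose k)"
  have c: "c > 0" using pos n unfolding c_def by simp
  have nk: "real (n - k) > 0" using Suc.prems by simp
  have b1: "real (n choose Suc k) = c / real (Suc k)" using e1 unfolding c_def by (simp add: field_simps)
  have b2: "real (n choose k) = c / real (n - k)" using e2 nk unfolding c_def by (simp add: field_simps)
  have Lx: "L = c * real x"
    using arg_cong[OF x, of real] unfolding L_def c_def n by (simp only: of_nat_mult)
  have Ly: "L = real (Suc n) * (c / real (n - k)) * real y"
    using arg_cong[OF y, of real] unfolding L_def b2[symmetric] by (simp only: of_nat_mult)
  have x': "real x = L / c" using Lx c by simp
  have y': "real y = L * real (n - k) / (real (Suc n) * c)"
    using Ly c nk by (simp add: nonzero_eq_divide_eq del: of_nat_Suc)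
  have "real (n - k) = real (Suc n) - real (Suc k)" using Suc.prems by simp
  then have "real (Suc n) * (c / real (Suc k)) * (L / c - L * real (n - k) / (real (Suc n) * c)) = L"
    using c by (simp add: divide_simps del: of_nat_Suc) (simp add: algebra_simps)
  then have "real (?f n (Suc k)) * (real x - real y) = L"
    unfolding x' y' of_nat_mult b1 .
  \<comment> \<open>The cofactor is the difference of \<open>x\<close> and \<open>y\<close>; it is
    formed in the integers, where subtraction is not truncated.\<close>
  then have "of_int (int (?f n (Suc k)) * (int x - int y)) = (of_int (int (Lcm {1..Suc n})) :: real)"
    unfolding L_def by simp
  then have "int (Lcm {1..Suc n}) = int (?f n (Suc k)) * (int x - int y)"
    by linarith
  then have "int (?f n (Suc k)) dvd int (Lcm {1..Suc n})" by (metis dvd_triv_left)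
  then show ?case by (simp only: int_dvd_int_iff)
qed

text \<open>The central binomial coefficient is at least \<open>4 ^ m / (2 * m)\<close>, and the
  factor \<open>2 * m + 1\<close> of the divisor found above absorbs the denominator, so the least
  common multiple grows exponentially.\<close>

lemma Lcm_atLeastAtMost_ge:
  assumes "n \<ge> 2"
  shows "2 ^ (n - 2) \<le> Lcm {1..n::nat}"
proof (cases "n \<le> 2")
  case True
  then show ?thesis using assms by (auto simp: Suc_le_eq Lcm_0_iff intro!: Nat.gr0I)
next
  case False
  \<comment> \<open>This is the largest \<open>m\<close> with \<open>2 * m + 1 \<le> n\<close>. Then
    \<open>n - 2 \<le> 2 * m\<close>, whence the exponent in the claim.\<close>
  define m where "m = (n - 1) div 2"
  have m: "m > 0" "2 * m + 1 \<le> n" "n \<le> 2 * m + 2" using False unfolding m_def by auto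
  have "4 ^ m \<le> 2 * real m * real ((2*m) choose m)"
    using central_binomial_lower_bound[OF m(1)] m(1) by (simp add: field_simps)
  also have "\<dots> \<le> real (Suc (2*m) * ((2*m) choose m))" by (simp add: field_simps)
  finally have "4 ^ m \<le> Suc (2*m) * ((2*m) choose m)"
    by (metis of_nat_le_iff of_nat_numeral of_nat_power)
  also have "\<dots> \<le> Lcm {1..n}"
  proof (rule dvd_imp_le)
    have "Suc (2*m) * ((2*m) choose m) dvd Lcm {1..Suc (2*m)}"
      by (rule mult_binomial_dvd_Lcm) simp
    also have "\<dots> dvd Lcm {1..n}" using m by (intro Lcm_subset) auto
    finally show "Suc (2*m) * ((2*m) choose m) dvd Lcm {1..n}" .
  qed (auto simp: Lcm_0_iff intro!: Nat.gr0I)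
  finally have "4 ^ m \<le> Lcm {1..n}" .
  moreover have "(2::nat) ^ (n - 2) \<le> 2 ^ (2 * m)" using m by (intro power_increasing) auto
  ultimately show ?thesis by (simp add: power_mult)
qed

text \<open>The multiplicity of \<open>p\<close> in a least common multiple is a maximum of
  multiplicities, so some member attains it.\<close>

lemma prime_power_dvd_Lcm:
  fixes p :: nat
  assumes "finite A" "prime p" "p ^ k dvd Lcm A" "0 \<notin> A" "k > 0"
  shows "\<exists>x\<in>A. p ^ k dvd x"
  using assms(1,3,4)
proof (induction A rule: finite_induct)
  case empty
  then show ?case using assms by auto
next
  case (insert x A)
  have nz: "Lcm A \<noteq> 0" using insert by (simp add: Lcm_0_iff)
  have "k \<le> multiplicity p (lcm x (Lcm A))"
  proof (rule multiplicity_geI)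
    show "\<not> is_unit p" using assms(2) by auto
    show "lcm x (Lcm A) \<noteq> 0" using insert nz by (auto simp: lcm_eq_0_iff)
    show "p ^ k dvd lcm x (Lcm A)" using insert by simp
  qed
  also have "\<dots> = max (multiplicity p x) (multiplicity p (Lcm A))"
    by (rule multiplicity_lcm) (use assms(2) insert.prems nz in auto)
  finally have "k \<le> multiplicity p x \<or> k \<le> multiplicity p (Lcm A)"
    by (simp only: le_max_iff_disj)
  then show ?case
  proof
    assume "k \<le> multiplicity p x"
    then have "p ^ k dvd x" by (rule multiplicity_dvd')
    then show ?thesis by (rule bexI) simp
  next
    assume "k \<le> multiplicity p (Lcm A)"
    then have "p ^ k dvd Lcm A" by (rule multiplicity_dvd')
    then obtain y where "y \<in> A" "p ^ k dvd y" using insert.IH insert.prems(2) by auto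
    then show ?thesis by (intro bexI[of _ y]) simp_all
  qed
qed

text \<open>Every prime power in the factorisation already divides a single number of the range,
  hence is at most \<open>n\<close>, and only primes up to \<open>n\<close> occur.\<close>

lemma Lcm_atLeastAtMost_le: "Lcm {1..n::nat} \<le> n ^ card {p. prime p \<and> p \<le> n}"
proof -
  let ?L = "Lcm {1..n}"
  have nz: "?L > 0" by (auto simp: Lcm_0_iff intro!: Nat.gr0I)
  have le: "p ^ multiplicity p ?L \<le> n" and le': "p \<le> n" if "p \<in> prime_factors ?L" for p
  proof -
    have p: "prime p" "multiplicity p ?L > 0"
      using that by (auto simp: prime_factors_multiplicity)
    obtain x where x: "x \<in> {1..n}" "p ^ multiplicity p ?L dvd x"
      using prime_power_dvd_Lcm[of "{1..n}" p "multiplicity p ?L"] p multiplicity_dvd[of p ?L] by auto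
    then show le: "p ^ multiplicity p ?L \<le> n" using dvd_imp_le[OF x(2)] by auto
    have "p ^ 1 \<le> p ^ multiplicity p ?L" using p by (intro power_increasing) (auto simp: prime_gt_0_nat Suc_leI)
    with le show "p \<le> n" by simp
  qed
  have "?L = (\<Prod>p\<in>prime_factors ?L. p ^ multiplicity p ?L)"
    using nz by (rule prime_factorization_nat)
  also have "\<dots> \<le> (\<Prod>p\<in>prime_factors ?L. n)" by (intro prod_mono conjI le) auto
  also have "\<dots> = n ^ card (prime_factors ?L)" by simp
  also have "\<dots> \<le> n ^ card {p. prime p \<and> p \<le> n}"
  proof (cases "n = 0")
    case False
    have "finite {p. prime p \<and> p \<le> n}" by (rule finite_subset[of _ "{..n}"]) auto
    then have "card (prime_factors ?L) \<le> card {p. prime p \<and> p \<le> n}"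
      by (rule card_mono) (use le' in_prime_factors_imp_prime in blast)
    then show ?thesis using False by (intro power_increasing) simp_all
  next
    case True
    have "{p::nat. prime p \<and> p \<le> 0} = {}" by auto
    then show ?thesis by (simp only: True) simp
  qed
  finally show ?thesis by (simp only:)
qed

text \<open>A Chebyshev bound, obtained by comparing the two estimates of the least common multiple
  and taking logarithms.\<close>

lemma card_primes_ge:
  assumes "n \<ge> 8"
  shows "real n / (2 * ln n) \<le> card {p::nat. prime p \<and> p \<le> n}"
proof -
  let ?c = "card {p::nat. prime p \<and> p \<le> n}"
  have "2 ^ (n - 2) \<le> n ^ ?c"
    using Lcm_atLeastAtMost_ge[of n] Lcm_atLeastAtMost_le[of n] assms by linarith
  then have "(2::real) ^ (n - 2) \<le> real n ^ ?c"
    by (metis of_nat_le_iff of_nat_numeral of_nat_power)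
  then have "ln ((2::real) ^ (n - 2)) \<le> ln (real n ^ ?c)"
    using assms by (subst ln_le_cancel_iff) auto
  then have "real (n - 2) * ln 2 \<le> ?c * ln n" using assms by (simp add: ln_realpow)
  \<comment> \<open>The number 2/3 is a lower bound for \<open>ln 2\<close>; the inequality is
    equivalent to \<open>n \<ge> 8\<close>.\<close>
  moreover have "real n / 2 \<le> real (n - 2) * (2/3)" using assms by (simp add: of_nat_diff)
  moreover have "real (n - 2) * (2/3) \<le> real (n - 2) * ln 2"
    using ln2_ge_two_thirds by (intro mult_left_mono) auto
  ultimately have "real n / 2 \<le> ?c * ln n" by linarith
  moreover have "ln (real n) > 0" using assms by simp
  ultimately show ?thesis by (simp add: field_simps)
qed

text \<open>The product of distinct primes dividing \<open>k\<close> divides \<open>k\<close>, and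
  each factor is at least 2. This limits the denominators that are exceptional for a given
  frequency.\<close>

lemma card_prime_divisors_le:
  fixes k :: nat
  assumes "finite P" "\<And>p. p \<in> P \<Longrightarrow> prime p" "\<And>p. p \<in> P \<Longrightarrow> p dvd k" "k > 0"
  shows "2 ^ card P \<le> k"
proof -
  have "(2::nat) ^ card P = (\<Prod>p\<in>P. 2)" by simp
  also have "\<dots> \<le> \<Prod>P" by (intro prod_mono) (auto simp: prime_ge_2_nat assms)
  also have "\<Prod>P dvd k"
    using assms(1-3)
  proof (induction P rule: finite_induct)
    case (insert p P)
    have "coprime p (\<Prod>P)"
      using insert.hyps insert.prems
      by (intro prod_coprime_right) (metis insertCI primes_coprime)
    with insert show ?case by (simp add: divides_mult)
  qed simp
  then have "\<Prod>P \<le> k" using assms(4) by (rule dvd_imp_le)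
  finally show ?thesis .
qed

section \<open>Weyl sums\<close>

definition ee :: "real \<Rightarrow> complex" where
  "ee u = cis (2 * pi * u)"

lemma ee_0 [simp]: "ee 0 = 1"
  by (simp add: ee_def)

lemma norm_ee [simp]: "norm (ee u) = 1"
  by (simp add: ee_def)

lemma ee_add: "ee (u + v) = ee u * ee v"
  by (simp add: ee_def cis_mult distrib_left)

lemma ee_of_int [simp]: "ee (of_int n) = 1"
  by (simp add: ee_def)

lemma cnj_ee: "cnj (ee u) = ee (- u)"
  by (simp add: ee_def cis_cnj)

lemma ee_sum: "finite A \<Longrightarrow> ee (\<Sum>x\<in>A. f x) = (\<Prod>x\<in>A. ee (f x))"
  by (induction A rule: finite_induct) (auto simp: ee_add)

lemma norm_ee_minus_1: "norm (ee u - 1) = 2 * \<bar>sin (pi * u)\<bar>"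
proof -
  have "ee u - 1 = cis (pi * u) * (cis (pi * u) - cis (- (pi * u)))"
    by (simp add: ee_def cis_mult right_diff_distrib mult.assoc[symmetric])
  also have "cis (pi * u) - cis (- (pi * u)) = 2 * \<i> * complex_of_real (sin (pi * u))"
    by (simp add: complex_eq_iff)
  finally show ?thesis by (simp add: norm_mult)
qed

text \<open>Jordan's inequality: a concave function lies above its chord.\<close>

lemma sin_ge_two_div_pi:
  assumes "0 \<le> x" "x \<le> pi / 2"
  shows "2 / pi * x \<le> sin x"
proof -
  have "convex_on {0..pi/2} (\<lambda>x. - sin x)"
  proof (rule f''_ge0_imp_convex)
    show "((\<lambda>x. - sin x) has_real_derivative - cos x) (at x)" for x :: real
      by (auto intro!: derivative_eq_intros)
    show "((\<lambda>x. - cos x) has_real_derivative sin x) (at x)" for x :: real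
      by (auto intro!: derivative_eq_intros)
    show "sin x \<ge> 0" if "x \<in> {0..pi/2}" for x :: real
      using that by (intro sin_ge_zero) auto
  qed auto
  then have "- sin ((1 - 2 / pi * x) *\<^sub>R 0 + (2 / pi * x) *\<^sub>R (pi / 2))
      \<le> (1 - 2 / pi * x) * (- sin 0) + (2 / pi * x) * (- sin (pi / 2))"
    by (rule convex_onD) (use assms in \<open>auto simp: field_simps\<close>)
  then show ?thesis by simp
qed

text \<open>By periodicity \<open>u\<close> may be replaced by its signed distance to the nearest
  integer, where Jordan's inequality applies.\<close>

lemma abs_sin_pi_ge:
  assumes "\<And>k::int. c \<le> \<bar>u - of_int k\<bar>"
  shows "2 * c \<le> \<bar>sin (pi * u)\<bar>"
proof -
  define v where "v = u - of_int (round u)"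
  have v: "\<bar>v\<bar> \<le> 1 / 2" using of_int_round_abs_le[of u] unfolding v_def by linarith
  have "\<bar>sin (pi * u)\<bar> = \<bar>sin (pi * v)\<bar>"
    using norm_ee_minus_1[of u] norm_ee_minus_1[of v] ee_add[of v "of_int (round u)"]
    unfolding v_def by simp
  also have "\<dots> = \<bar>sin (pi * \<bar>v\<bar>)\<bar>" by (simp add: abs_if)
  also have "\<dots> \<ge> 2 / pi * (pi * \<bar>v\<bar>)"
    by (rule order_trans[OF sin_ge_two_div_pi]) (use v in \<open>auto simp: field_simps\<close>)
  finally show ?thesis using assms[of "round u"] unfolding v_def by simp
qed

text \<open>Multiplication by \<open>ee u - 1\<close> makes the sum telescope. The product form
  covers the zeros of the sine without an exception.\<close>

lemma norm_geometric_sum_le: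
  "norm (\<Sum>n=a..b. ee (of_int n * u)) * \<bar>sin (pi * u)\<bar> \<le> 1"
proof (cases "a \<le> b")
  case True
  have "(\<Sum>n=a..b. ee (of_int n * u)) * (ee u - 1) = ee (of_int (b + 1) * u) - ee (of_int a * u)"
    using True
  proof (induction b rule: int_ge_induct)
    case base
    then show ?case by (simp add: ee_add algebra_simps)
  next
    case (step b)
    have "{a..b + 1} = insert (b + 1) {a..b}" using step by auto
    then have "(\<Sum>n=a..b + 1. ee (of_int n * u)) * (ee u - 1)
        = ee (of_int (b + 1) * u) * (ee u - 1) + (ee (of_int (b + 1) * u) - ee (of_int a * u))"
      using step.IH by (simp add: distrib_right)
    moreover have "ee (of_int (b + 1 + 1) * u) = ee (of_int (b + 1) * u) * ee u"
      by (simp add: ee_add[symmetric] algebra_simps)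
    ultimately show ?case by (simp add: right_diff_distrib)
  qed
  then have "norm (\<Sum>n=a..b. ee (of_int n * u)) * norm (ee u - 1)
      = norm (ee (of_int (b + 1) * u) - ee (of_int a * u))"
    by (metis norm_mult)
  also have "\<dots> \<le> 2"
    by (rule order_trans[OF norm_triangle_ineq4]) simp
  finally show ?thesis by (simp add: norm_ee_minus_1)
qed simp

section \<open>Weyl's inequality near fractions with prime denominator\<close>

definition weyl_sum :: "nat \<Rightarrow> real \<Rightarrow> real \<Rightarrow> complex" where
  "weyl_sum N x t = (\<Sum>n=-int N..int N. ee (of_int n * x + (of_int n)\<^sup>2 * t))"

lemma norm_weyl_sum_le: "norm (weyl_sum N x t) \<le> 2 * real N + 1"
  unfolding weyl_sum_def by (rule order_trans[OF norm_sum]) simp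

text \<open>After squaring, the substitution \<open>n = m + h\<close> makes the quadratic phase
  linear in \<open>m\<close>, so each inner sum is geometric, and \<open>x\<close> survives only in
  a factor of modulus 1. The shift \<open>h = 0\<close> gives the diagonal term.\<close>

lemma weyl_differencing:
  assumes "\<And>h. h \<noteq> 0 \<Longrightarrow> \<bar>h\<bar> \<le> 2 * int N \<Longrightarrow> 0 < s h \<and> s h \<le> \<bar>sin (pi * (2 * of_int h * t))\<bar>"
  shows "(norm (weyl_sum N x t))\<^sup>2 \<le> 2 * real N + 1 + (\<Sum>h\<in>{-2 * int N..2 * int N} - {0}. 1 / s h)"
proof -
  let ?I = "{-int N..int N}" and ?H = "{-2 * int N..2 * int N}"
  \<comment> \<open>\<open>?J h\<close> consists of the \<open>m\<close> for which both
    \<open>m\<close> and \<open>m + h\<close> lie in \<open>?I\<close>.\<close>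
  let ?J = "\<lambda>h. {max (-int N) (-int N - h)..min (int N) (int N - h)}"
  let ?f = "\<lambda>n. of_int n * x + (of_int n)\<^sup>2 * t"
  define T where "T h = (\<Sum>m\<in>?J h. ee (of_int m * (2 * of_int h * t)))" for h
  have "complex_of_real ((norm (weyl_sum N x t))\<^sup>2) = weyl_sum N x t * cnj (weyl_sum N x t)"
    by (rule complex_norm_square)
  also have "\<dots> = (\<Sum>(n, m)\<in>?I \<times> ?I. ee (?f n - ?f m))"
    unfolding weyl_sum_def cnj_sum sum_product sum.cartesian_product
    by (intro sum.cong refl) (auto simp: cnj_ee ee_add[symmetric] algebra_simps)
  also have "\<dots> = (\<Sum>(h, m)\<in>(SIGMA h:?H. ?J h). ee (?f h) * ee (of_int m * (2 * of_int h * t)))"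
    by (rule sum.reindex_bij_witness[where i = "\<lambda>(h, m). (m + h, m)" and j = "\<lambda>(n, m). (n - m, m)"])
       (auto simp: ee_add[symmetric] power2_eq_square algebra_simps)
  also have "\<dots> = (\<Sum>h\<in>?H. ee (?f h) * T h)"
    unfolding T_def sum_distrib_left by (subst sum.Sigma) auto
  finally have "(norm (weyl_sum N x t))\<^sup>2 = norm (\<Sum>h\<in>?H. ee (?f h) * T h)"
    by (metis abs_power2 norm_of_real)
  also have "\<dots> \<le> (\<Sum>h\<in>?H. norm (T h))"
    by (rule order_trans[OF norm_sum]) (simp add: norm_mult)
  also have "\<dots> = norm (T 0) + (\<Sum>h\<in>?H - {0}. norm (T h))"
    by (subst sum.remove[of _ 0]) auto
  also have "\<dots> \<le> (2 * real N + 1) + (\<Sum>h\<in>?H - {0}. 1 / s h)"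
  proof (intro add_mono sum_mono)
    show "norm (T 0) \<le> 2 * real N + 1"
      unfolding T_def by (rule order_trans[OF norm_sum]) simp
    fix h assume "h \<in> ?H - {0}"
    then have s: "0 < s h" "s h \<le> \<bar>sin (pi * (2 * of_int h * t))\<bar>" using assms[of h] by auto
    have "norm (T h) * s h \<le> norm (T h) * \<bar>sin (pi * (2 * of_int h * t))\<bar>"
      using s by (intro mult_left_mono) auto
    also have "\<dots> \<le> 1" unfolding T_def by (rule norm_geometric_sum_le)
    finally show "norm (T h) \<le> 1 / s h" using s by (simp add: field_simps)
  qed
  finally show ?thesis by simp
qed

lemma prime_two_mult_dvd_imp:
  fixes a h :: int and q :: nat
  assumes "prime q" "0 < a" "a < int q" "2 < q" "int q dvd 2 * h * a"
  shows "int q dvd h"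
proof -
  have "prime (int q)" using assms by simp
  then have "int q dvd 2 \<or> int q dvd h \<or> int q dvd a"
    using assms(5) by (simp add: prime_dvd_mult_iff)
  moreover have "\<not> int q dvd 2" "\<not> int q dvd a"
    using assms zdvd_imp_le[of "int q" 2] zdvd_imp_le[of "int q" a] by auto
  ultimately show ?thesis by simp
qed

text \<open>For \<open>t\<close> near \<open>a / q\<close>, the number \<open>2 * h * t\<close> is
  modulo 1 close to \<open>r h / q\<close>, where \<open>r h\<close> is the residue of
  \<open>2 * h * a\<close>. Since \<open>q\<close> is a prime larger than \<open>4 * N\<close>,
  these residues are nonzero and distinct, so the reciprocals from differencing add up to at most
  two harmonic sums.\<close>

lemma weyl_bound:
  fixes N q :: nat and a k :: int
  assumes "prime q" "q > 4 * N" "N \<ge> 1" "0 < a" "a < int q"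
    and t: "\<bar>t - of_int a / real q - of_int k\<bar> \<le> 1 / (8 * real N * real q)"
  shows "(norm (weyl_sum N x t))\<^sup>2 \<le> 2 * real q * (2 + ln q)"
proof -
  define r where "r h = (2 * h * a) mod int q" for h
  \<comment> \<open>Up to the factor \<open>q\<close>, the sum of the two reciprocals dominates the
    reciprocal of the distance from the residue to the nearest multiple of \<open>q\<close>, and it
    is easy to sum.\<close>
  define g where "g r = real q * (1 / of_int r + 1 / (real q - of_int r))" for r :: int
  let ?H = "{-2 * int N..2 * int N} - {0}"
  have q: "real q > 0" using assms by simp
  have r_range: "0 < r h" "r h < int q" if "h \<in> ?H" for h
  proof -
    have "\<not> int q dvd h"
      using that assms zdvd_imp_le[of "int q" "\<bar>h\<bar>"] by auto
    then have "r h \<noteq> 0"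
      using prime_two_mult_dvd_imp[of q a h] assms unfolding r_def by (auto simp: mod_eq_0_iff_dvd)
    moreover have "0 \<le> r h" "r h < int q" using assms unfolding r_def by auto
    ultimately show "0 < r h" "r h < int q" by auto
  qed
  have inj: "inj_on r ?H"
  proof (rule inj_onI)
    fix h h' assume h: "h \<in> ?H" "h' \<in> ?H" and "r h = r h'"
    then have "int q dvd 2 * (h - h') * a"
      unfolding r_def by (simp add: mod_eq_dvd_iff algebra_simps)
    then have "int q dvd (h - h')"
      by (rule prime_two_mult_dvd_imp[rotated 4]) (use assms in auto)
    moreover have "\<bar>h - h'\<bar> < int q" using h assms by auto
    ultimately show "h = h'" using zdvd_imp_le[of "int q" "\<bar>h - h'\<bar>"] by auto
  qed
  have low: "1 / g (r h) \<le> \<bar>sin (pi * (2 * of_int h * t))\<bar>" and gpos: "0 < g (r h)" if h: "h \<in> ?H" for h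
  proof -
    define m where "m = min (of_int (r h)) (real q - of_int (r h))"
    have m: "m \<ge> 1" using r_range[OF h] unfolding m_def by auto
    have "m / (2 * real q) \<le> \<bar>2 * of_int h * t - of_int j\<bar>" for j :: int
    proof -
      define \<beta> where "\<beta> = t - of_int a / real q - of_int k"
      \<comment> \<open>\<open>i / q\<close> is the value of \<open>2 * h * t - j\<close> at the
        centre \<open>t = a / q + k\<close>; modulo \<open>q\<close> its numerator is
        \<open>r h\<close>.\<close>
      define i where "i = 2 * h * a - int q * (j - 2 * h * k)"
      have "i = r h + int q * ((2 * h * a) div int q - (j - 2 * h * k))"
        unfolding i_def r_def by (simp add: algebra_simps flip: minus_mult_div_eq_mod)
      then obtain l where l: "i = r h + int q * l" by blast
      have "m \<le> \<bar>of_int i\<bar>"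
      proof (cases "l \<ge> 0")
        case True
        then have "r h \<le> i" unfolding l by simp
        then show ?thesis unfolding m_def by linarith
      next
        case False
        then have "int q * l \<le> int q * (-1)" by (intro mult_left_mono) auto
        then have "i \<le> r h - int q" unfolding l by simp
        then have "of_int i \<le> of_int (r h) - real q" by linarith
        then show ?thesis unfolding m_def by linarith
      qed
      then have "m / real q \<le> \<bar>of_int i / real q\<bar>"
        using q by (simp add: divide_right_mono)
      moreover have "2 * of_int h * t - of_int j = of_int i / real q + 2 * of_int h * \<beta>"
        using q unfolding i_def \<beta>_def by (simp add: field_simps)
      moreover have "\<bar>2 * of_int h * \<beta>\<bar> \<le> 1 / (2 * real q)"
      proof -
        have "\<bar>h\<bar> \<le> 2 * int N" using h by auto
        then have "\<bar>2 * real_of_int h\<bar> \<le> 4 * real N" by linarith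
        then have "\<bar>2 * of_int h * \<beta>\<bar> \<le> (4 * real N) * (1 / (8 * real N * real q))"
          unfolding abs_mult[of "2 * of_int h" \<beta>] using t[folded \<beta>_def] by (rule mult_mono) auto
        also have "\<dots> = 1 / (2 * real q)" using assms by (simp add: field_simps)
        finally show ?thesis .
      qed
      ultimately have "m / real q - 1 / (2 * real q) \<le> \<bar>2 * of_int h * t - of_int j\<bar>"
        by linarith
      \<comment> \<open>Since \<open>m \<ge> 1\<close>, the displacement of \<open>t\<close> from
        the centre costs at most half of \<open>m / q\<close>.\<close>
      moreover have "m / (2 * real q) \<le> m / real q - 1 / (2 * real q)"
        using m q by (simp add: field_simps)
      ultimately show ?thesis by linarith
    qed
    then have s: "2 * (m / (2 * real q)) \<le> \<bar>sin (pi * (2 * of_int h * t))\<bar>"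
      by (rule abs_sin_pi_ge)
    have pos: "real_of_int (r h) > 0" "real q - of_int (r h) > 0" using r_range[OF h] by auto
    then show "0 < g (r h)" using q unfolding g_def by (intro mult_pos_pos add_pos_pos) auto
    have "1 / m \<le> 1 / of_int (r h) + 1 / (real q - of_int (r h))"
      using pos unfolding m_def min_def by auto
    then have "real q / m \<le> g (r h)"
      using q unfolding g_def by (simp add: divide_inverse mult_left_mono)
    then have "1 / g (r h) \<le> 1 / (real q / m)"
      using m q \<open>0 < g (r h)\<close> by (intro divide_left_mono) auto
    then show "1 / g (r h) \<le> \<bar>sin (pi * (2 * of_int h * t))\<bar>" using s by simp
  qed
  have "(norm (weyl_sum N x t))\<^sup>2 \<le> 2 * real N + 1 + (\<Sum>h\<in>?H. 1 / (1 / g (r h)))"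
  proof (rule weyl_differencing)
    fix h :: int assume "h \<noteq> 0" "\<bar>h\<bar> \<le> 2 * int N"
    then have h: "h \<in> ?H" by auto
    show "0 < 1 / g (r h) \<and> 1 / g (r h) \<le> \<bar>sin (pi * (2 * of_int h * t))\<bar>"
      using low[OF h] gpos[OF h] by simp
  qed
  also have "(\<Sum>h\<in>?H. 1 / (1 / g (r h))) = (\<Sum>i\<in>r ` ?H. g i)"
    using inj by (simp add: sum.reindex)
  also have "\<dots> \<le> (\<Sum>i\<in>{1..int q - 1}. g i)"
    using r_range q by (intro sum_mono2) (fastforce simp: g_def)+
  also have "\<dots> = real q * ((\<Sum>i=1..int q - 1. 1 / of_int i) + (\<Sum>i=1..int q - 1. 1 / (real q - of_int i)))"
    by (simp only: g_def sum_distrib_left[symmetric] sum.distrib)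
  also have "(\<Sum>i=1..int q - 1. 1 / (real q - of_int i)) = (\<Sum>i=1..int q - 1. 1 / of_int i)"
    by (rule sum.reindex_bij_witness[where i = "\<lambda>i. int q - i" and j = "\<lambda>i. int q - i"]) auto
  also have "(\<Sum>i=1..int q - 1. 1 / of_int i) = (harm (q - 1) :: real)"
    unfolding harm_def
    by (rule sum.reindex_bij_witness[where i = int and j = nat]) (auto simp: inverse_eq_divide)
  also have "2 * real N + 1 + real q * (harm (q - 1) + harm (q - 1)) \<le> real q + real q * (2 * (1 + ln q))"
  proof -
    \<comment> \<open>The sequence \<open>harm n - ln n\<close> decreases and has the value 1 at
      \<open>n = 1\<close>.\<close>
    have "harm (q - 1) - ln (real (q - 1)) \<le> harm 1 - ln (real 1 :: real)"
      using euler_mascheroni_sequence_decreasing[of 1 "q - 1"] assms by auto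
    moreover have "ln (real (q - 1)) \<le> ln (real q)" using assms by (subst ln_le_cancel_iff) auto
    ultimately have "harm (q - 1) \<le> 1 + ln q" by (simp add: harm_def)
    then have "real q * (harm (q - 1) + harm (q - 1)) \<le> real q * (2 * (1 + ln q))"
      by (intro mult_left_mono) auto
    moreover have "2 * real N + 1 \<le> real q" using assms by linarith
    ultimately show ?thesis by linarith
  qed
  also have "\<dots> \<le> 2 * real q * (2 + ln q)" using q by (simp add: algebra_simps)
  finally show ?thesis by simp
qed

section \<open>A kernel concentrated near fractions with prime denominators\<close>

text \<open>Induction on the squared inequality, where the recursion of the central binomial
  coefficient reduces the step to \<open>4 * n * (n + 1) \<le> (2 * n + 1)\<^sup>2\<close>. Losing
  only a square root keeps the kernel of height \<open>sqrt L\<close>.\<close>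

lemma central_binomial_ge:
  assumes "n \<ge> 1"
  shows "4 ^ n \<le> 2 * sqrt n * real ((2 * n) choose n)"
proof -
  have "(4 ^ n)\<^sup>2 \<le> 4 * real n * (real ((2 * n) choose n))\<^sup>2"
    using assms
  proof (induction n rule: nat_induct_at_least)
    case base
    then show ?case by simp
  next
    case (Suc n)
    define b where "b = real ((2 * n) choose n)"
    have "Suc n * ((2 * Suc n) choose Suc n) = 2 * (2 * n + 1) * ((2 * n) choose n)"
    proof -
      have "(2 * Suc n) choose Suc n = 2 * ((2 * n + 1) choose n)"
        using binomial_symmetric[of "Suc n" "2 * n + 1"] by simp
      moreover have "Suc n * ((2 * n + 1) choose Suc n) = (2 * n + 1) * ((2 * n) choose n)"
        using Suc_times_binomial_eq[of "2 * n" n] by simp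
      moreover have "(2 * n + 1) choose Suc n = (2 * n + 1) choose n"
        using binomial_symmetric[of "Suc n" "2 * n + 1"] by simp
      ultimately show ?thesis by (metis mult.assoc mult.left_commute)
    qed
    from arg_cong[OF this, of real]
    have "real (Suc n) * real ((2 * Suc n) choose Suc n) = 2 * (2 * real n + 1) * b"
      unfolding b_def by (simp only: of_nat_mult of_nat_add of_nat_numeral of_nat_1)
    then have eq: "real ((2 * Suc n) choose Suc n) = 2 * (2 * real n + 1) * b / real (Suc n)"
      by (simp add: field_simps del: binomial_Suc_Suc of_nat_Suc)
    have "(4 ^ Suc n)\<^sup>2 = 16 * ((4::real) ^ n)\<^sup>2" by (simp add: power_mult_distrib)
    also have "\<dots> \<le> 16 * (4 * real n * b\<^sup>2)" using Suc.IH unfolding b_def by simp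
    also have "\<dots> = 16 * b\<^sup>2 / real (Suc n) * (4 * real n * real (Suc n))"
      by (simp add: field_simps del: of_nat_Suc)
    also have "\<dots> \<le> 16 * b\<^sup>2 / real (Suc n) * (2 * real n + 1)\<^sup>2"
      by (intro mult_left_mono) (simp_all add: power2_eq_square algebra_simps)
    also have "\<dots> = 4 * real (Suc n) * (real ((2 * Suc n) choose Suc n))\<^sup>2"
      unfolding eq by (simp add: power2_eq_square field_simps del: of_nat_Suc)
    finally show ?case .
  qed
  then have "sqrt ((4 ^ n)\<^sup>2) \<le> sqrt (4 * real n * (real ((2 * n) choose n))\<^sup>2)"
    by (rule real_sqrt_le_mono)
  then show ?thesis by (simp add: real_sqrt_mult)
qed

text \<open>
  The even powers of the cosine are positive trigonometric polynomials that concentrate like a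
  Gaussian of width \<open>1 / sqrt L\<close>; here they are normalised to have mean value 1.  The values
  of \<open>cos_coeff L k\<close> with \<open>k < - L\<close> are junk (\<open>nat\<close> truncates).
\<close>

definition cos_kernel :: "nat \<Rightarrow> real \<Rightarrow> real" where
  "cos_kernel L u = 4 ^ L / real ((2 * L) choose L) * cos (pi * u) ^ (2 * L)"

definition cos_coeff :: "nat \<Rightarrow> int \<Rightarrow> real" where
  "cos_coeff L k = real ((2 * L) choose nat (int L + k)) / real ((2 * L) choose L)"

lemma cos_coeff_0 [simp]: "cos_coeff L 0 = 1"
  by (simp add: cos_coeff_def)

lemma cos_coeff_nonneg: "0 \<le> cos_coeff L k"
  by (simp add: cos_coeff_def)

lemma cos_coeff_le_1: "cos_coeff L k \<le> 1"
  by (simp add: cos_coeff_def binomial_maximum')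

lemma cos_kernel_nonneg: "0 \<le> cos_kernel L u"
  by (simp add: cos_kernel_def)

text \<open>The binomial theorem for \<open>(2 * cos (pi * u)) ^ (2 * L)\<close>, written as a sum
  of two exponentials; term \<open>j\<close> has frequency \<open>j - L\<close>.\<close>

lemma cos_kernel_expansion:
  "complex_of_real (cos_kernel L u) = (\<Sum>k=-int L..int L. of_real (cos_coeff L k) * ee (of_int k * u))"
proof -
  have "4 ^ L * complex_of_real (cos (pi * u)) ^ (2 * L) = (2 * complex_of_real (cos (pi * u))) ^ (2 * L)"
    by (simp add: power_mult_distrib power_mult)
  also have "2 * complex_of_real (cos (pi * u)) = cis (pi * u) + cis (- (pi * u))"
    by (simp add: complex_eq_iff)
  also have "(cis (pi * u) + cis (- (pi * u))) ^ (2 * L)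
      = (\<Sum>j\<le>2 * L. of_nat ((2 * L) choose j) * ee ((real j - real L) * u))"
    unfolding binomial_ring
  proof (intro sum.cong refl)
    fix j assume "j \<in> {..2 * L}"
    then have "cis (pi * u) ^ j * cis (- (pi * u)) ^ (2 * L - j) = ee ((real j - real L) * u)"
      unfolding ee_def Complex.DeMoivre cis_mult
      by (intro arg_cong[of _ _ cis]) (simp add: of_nat_diff algebra_simps)
    then show "of_nat ((2 * L) choose j) * cis (pi * u) ^ j * cis (- (pi * u)) ^ (2 * L - j)
        = of_nat ((2 * L) choose j) * ee ((real j - real L) * u)"
      by (simp only: mult.assoc)
  qed
  also have "\<dots> = (\<Sum>k=-int L..int L. of_nat ((2 * L) choose nat (int L + k)) * ee (of_int k * u))"
    by (rule sum.reindex_bij_witness[where i = "\<lambda>k. nat (int L + k)" and j = "\<lambda>j. int j - int L"]) auto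
  finally have "complex_of_real (cos_kernel L u) =
      (\<Sum>k=-int L..int L. of_nat ((2 * L) choose nat (int L + k)) * ee (of_int k * u)) / of_nat ((2 * L) choose L)"
    by (simp add: cos_kernel_def)
  then show ?thesis
    by (simp add: cos_coeff_def sum_divide_distrib)
qed

lemma cos_kernel_le:
  assumes "L \<ge> 1"
  shows "cos_kernel L u \<le> 2 * sqrt L"
proof -
  have "4 ^ L / real ((2 * L) choose L) \<le> 2 * sqrt L"
    using central_binomial_ge[OF assms] by (simp add: field_simps)
  moreover have "cos (pi * u) ^ (2 * L) \<le> 1"
    unfolding power_mult by (rule power_le_one) (auto simp: abs_square_le_1)
  ultimately have "cos_kernel L u \<le> 2 * sqrt L * 1"
    unfolding cos_kernel_def by (intro mult_mono) (auto simp: power_mult)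
  then show ?thesis by simp
qed

text \<open>Away from the integers the squared cosine is at most
  \<open>1 - 4 * \<delta>\<^sup>2\<close>, hence at most
  \<open>exp (- 4 * \<delta>\<^sup>2)\<close>; the \<open>L\<close>-th power gives the Gaussian
  tail.\<close>

lemma cos_kernel_decay:
  assumes "L \<ge> 1" "0 \<le> \<delta>" "\<And>k::int. \<delta> \<le> \<bar>u - of_int k\<bar>"
  shows "cos_kernel L u \<le> 2 * sqrt L * exp (- 4 * \<delta>\<^sup>2 * L)"
proof -
  have "(2 * \<delta>)\<^sup>2 \<le> \<bar>sin (pi * u)\<bar>\<^sup>2"
    using abs_sin_pi_ge[of \<delta> u] assms by (intro power_mono) auto
  then have "(cos (pi * u))\<^sup>2 \<le> 1 + (- 4 * \<delta>\<^sup>2)"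
    using cos_squared_eq[of "pi * u"] by (simp add: power_mult_distrib)
  also have "\<dots> \<le> exp (- 4 * \<delta>\<^sup>2)" by (rule exp_ge_add_one_self)
  finally have "cos (pi * u) ^ (2 * L) \<le> exp (- 4 * \<delta>\<^sup>2) ^ L"
    unfolding power_mult by (intro power_mono) auto
  also have "\<dots> = exp (- 4 * \<delta>\<^sup>2 * L)" by (simp add: exp_of_nat_mult[symmetric] mult.commute)
  finally have "cos (pi * u) ^ (2 * L) \<le> exp (- 4 * \<delta>\<^sup>2 * L)" .
  moreover have "4 ^ L / real ((2 * L) choose L) \<le> 2 * sqrt L"
    using central_binomial_ge[OF assms(1)] by (simp add: field_simps)
  ultimately show ?thesis
    unfolding cos_kernel_def by (intro mult_mono) (auto simp: power_mult)
qed

section \<open>Fractions with prime denominators\<close>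

text \<open>With the missing term \<open>a = 0\<close> the sum runs over all powers of a
  \<open>q\<close>-th root of unity and vanishes unless that root is 1; so the value is
  \<open>- 1\<close> when \<open>q\<close> does not divide \<open>k\<close>.\<close>

lemma norm_sum_nontrivial_characters_le:
  fixes q :: nat and k :: int
  assumes "q \<ge> 1"
  shows "norm (\<Sum>a=1..<q. ee (- of_int k * (real a / real q))) \<le> (if int q dvd k then real q else 1)"
proof (cases "int q dvd k")
  case True
  have "norm (\<Sum>a=1..<q. ee (- of_int k * (real a / real q))) \<le> real (q - 1)"
    by (rule order_trans[OF norm_sum]) simp
  then show ?thesis using True by simp
next
  case False
  define z where "z = ee (- of_int k / real q)"
  have pow: "z ^ j = ee (- of_int k * (real j / real q))" for j
    unfolding z_def ee_def Complex.DeMoivre by (simp add: field_simps)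
  have zq: "z ^ q = 1"
    unfolding pow using assms ee_of_int[of "-k"] by simp
  have "z \<noteq> 1"
  proof
    assume "z = 1"
    then have "\<bar>sin (pi * (- of_int k / real q))\<bar> = 0"
      using norm_ee_minus_1[of "- of_int k / real q"] unfolding z_def by simp
    then have "sin (pi * (- of_int k / real q)) = 0" by simp
    then obtain i :: int where i: "pi * (- of_int k / real q) = of_int i * pi"
      unfolding sin_zero_iff_int2 by blast
    then have "- of_int k / real q = of_int i"
      by (simp only: mult.commute[of "of_int i" pi] mult_left_cancel[OF pi_neq_zero])
    then have "real_of_int (-k) = of_int (i * int q)"
      using assms by (simp add: field_simps)
    then have "- k = i * int q" by linarith
    then have "k = int q * (- i)" by algebra
    with False show False by simp
  qed
  then have "(\<Sum>a<q. z ^ a) = 0" using geometric_sum[of z q] zq by simp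
  moreover have "{..<q} = insert 0 {1..<q}" using assms by auto
  ultimately have "(\<Sum>a=1..<q. z ^ a) = - 1"
    by (simp add: add_eq_0_iff)
  then show ?thesis using False unfolding pow by simp
qed

text \<open>The difference modulo 1 is an integer \<open>i\<close> over \<open>q * q'\<close>, so
  being smaller than \<open>1 / Q\<^sup>2\<close> forces \<open>i = 0\<close>. As the fractions are
  reduced, the denominators and then the numerators agree.\<close>

lemma farey_separation:
  fixes q q' a a' :: nat and m :: int and Q :: real
  assumes "prime q" "prime q'" "0 < a" "a < q" "0 < a'" "a' < q'" "real q \<le> Q" "real q' \<le> Q"
    and "\<bar>real a' / real q' - real a / real q - of_int m\<bar> < 1 / Q\<^sup>2"
  shows "q = q' \<and> a = a'"
proof -
  define i where "i = int a' * int q - int a * int q' - m * int q * int q'"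
  have pos: "real q > 0" "real q' > 0" using assms by auto
  have "real a' / real q' - real a / real q - of_int m = of_int i / (real q * real q')"
    using pos unfolding i_def by (simp add: field_simps)
  then have "\<bar>of_int i\<bar> / (real q * real q') < 1 / Q\<^sup>2"
    using assms(9) pos by (simp add: abs_mult)
  also have "\<dots> \<le> 1 / (real q * real q')"
    unfolding power2_eq_square using assms pos by (intro divide_left_mono mult_mono mult_pos_pos) auto
  finally have "\<bar>real_of_int i\<bar> < 1" using pos by (simp add: divide_less_cancel)
  then have "i = 0" by linarith
  then have eq: "int a' * int q = int q' * (int a + m * int q)" unfolding i_def by (simp add: algebra_simps)
  then have "int q' dvd int a' * int q" by simp
  then have "q' dvd a' * q" by (metis int_dvd_int_iff of_nat_mult)
  then have "q' dvd a' \<or> q' dvd q" using assms(2) by (simp add: prime_dvd_mult_iff)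
  moreover have "\<not> q' dvd a'" using assms(5,6) by (auto dest: dvd_imp_le)
  ultimately have "q' dvd q" by simp
  then have q: "q = q'" using primes_dvd_imp_eq[of q' q] assms(1,2) by simp
  then have "int a' = int a + m * int q" using eq pos by (simp add: mult.commute)
  then have "int q dvd int a' - int a" by simp
  moreover have "\<bar>int a' - int a\<bar> < int q" using assms q by auto
  ultimately have "int a' - int a = 0" using zdvd_imp_le[of "int q" "\<bar>int a' - int a\<bar>"] by auto
  then show ?thesis using q by simp
qed


text \<open>The fraction \<open>a / q\<close> is kept as the pair \<open>(q, a)\<close>. Leaving out
  \<open>a = 0\<close> makes all fractions reduced, so distinct pairs are distinct points of the
  circle.\<close>

definition farey_points :: "real \<Rightarrow> nat \<Rightarrow> (nat \<times> nat) set" where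
  "farey_points Y Q = (SIGMA q:{q. prime q \<and> Y < real q \<and> q \<le> Q}. {1..<q})"

lemma finite_primes_between: "finite {q::nat. prime q \<and> Y < real q \<and> q \<le> Q}"
  by (rule finite_subset[of _ "{..Q}"]) auto

lemma finite_farey_points: "finite (farey_points Y Q)"
  unfolding farey_points_def by (intro finite_SigmaI finite_primes_between) auto

text \<open>After scaling by \<open>Q\<^sup>2\<close>, separation puts the displacements from
  \<open>t\<close> into different unit cells, and only the cells meeting an interval of half-length
  \<open>\<delta> * Q\<^sup>2\<close> are available.\<close>

lemma card_farey_points_near_le:
  assumes "0 \<le> \<delta>" "Q \<ge> 1"
  shows "real (card {(q, a) \<in> farey_points Y Q. \<exists>k::int. \<bar>t - real a / real q - of_int k\<bar> \<le> \<delta>})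
    \<le> 2 * (\<delta> * (real Q)\<^sup>2) + 2"
proof -
  let ?S = "{(q, a) \<in> farey_points Y Q. \<exists>k::int. \<bar>t - real a / real q - of_int k\<bar> \<le> \<delta>}"
  have "\<forall>z\<in>?S. \<exists>k::int. \<bar>t - real (snd z) / real (fst z) - of_int k\<bar> \<le> \<delta>" by auto
  from bchoice[OF this] obtain k :: "nat \<times> nat \<Rightarrow> int"
    where k: "\<And>z. z \<in> ?S \<Longrightarrow> \<bar>t - real (snd z) / real (fst z) - of_int (k z)\<bar> \<le> \<delta>" by blast
  define u where "u z = t - real (snd z) / real (fst z) - of_int (k z)" for z
  define D where "D = \<delta> * (real Q)\<^sup>2"
  have Q: "(real Q)\<^sup>2 > 0" using assms by simp
  have D: "D \<ge> 0" using assms unfolding D_def by simp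
  have "inj_on (\<lambda>z. \<lfloor>u z * (real Q)\<^sup>2\<rfloor>) ?S"
  proof (rule inj_onI)
    fix z z' assume z: "z \<in> ?S" "z' \<in> ?S" and eq: "\<lfloor>u z * (real Q)\<^sup>2\<rfloor> = \<lfloor>u z' * (real Q)\<^sup>2\<rfloor>"
    then have "\<bar>u z * (real Q)\<^sup>2 - u z' * (real Q)\<^sup>2\<bar> < 1" by linarith
    then have "\<bar>(u z - u z') * (real Q)\<^sup>2\<bar> < 1" by (simp add: left_diff_distrib)
    then have "\<bar>u z - u z'\<bar> * (real Q)\<^sup>2 < 1" by (simp add: abs_mult)
    then have "\<bar>u z - u z'\<bar> < 1 / (real Q)\<^sup>2" using Q by (simp add: field_simps)
    then have "\<bar>real (snd z') / real (fst z') - real (snd z) / real (fst z) - of_int (k z - k z')\<bar> < 1 / (real Q)\<^sup>2"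
      unfolding u_def by (simp add: algebra_simps)
    then have "fst z = fst z' \<and> snd z = snd z'"
      by (rule farey_separation[rotated -1]) (use z in \<open>auto simp: farey_points_def\<close>)
    then show "z = z'" by (simp add: prod_eq_iff)
  qed
  moreover have "(\<lambda>z. \<lfloor>u z * (real Q)\<^sup>2\<rfloor>) ` ?S \<subseteq> {\<lfloor>- D\<rfloor>..\<lfloor>D\<rfloor>}"
  proof (rule image_subsetI)
    fix z assume "z \<in> ?S"
    then have "\<bar>u z\<bar> \<le> \<delta>" using k unfolding u_def by blast
    then have "\<bar>u z * (real Q)\<^sup>2\<bar> \<le> D" unfolding D_def abs_mult using Q by simp
    then have "- D \<le> u z * (real Q)\<^sup>2" "u z * (real Q)\<^sup>2 \<le> D" by linarith+
    then show "\<lfloor>u z * (real Q)\<^sup>2\<rfloor> \<in> {\<lfloor>- D\<rfloor>..\<lfloor>D\<rfloor>}"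
      by (simp only: atLeastAtMost_iff floor_mono)
  qed
  ultimately have "card ?S \<le> card {\<lfloor>- D\<rfloor>..\<lfloor>D\<rfloor>}"
    by (intro card_inj_on_le[of "\<lambda>z. \<lfloor>u z * (real Q)\<^sup>2\<rfloor>"]) auto
  also have "\<dots> = nat (\<lfloor>D\<rfloor> - \<lfloor>- D\<rfloor> + 1)" by simp
  finally have "real (card ?S) \<le> of_int (\<lfloor>D\<rfloor> - \<lfloor>- D\<rfloor> + 1)" using D by linarith
  also have "\<dots> \<le> 2 * D + 2" by linarith
  finally show ?thesis unfolding D_def .
qed

text \<open>There are at least \<open>4 * Q / D\<close> primes up to \<open>Q\<close>, of which at
  most \<open>Q / D\<close> are discarded as too small. Each remaining one carries at least
  \<open>Q / D - 1\<close> numerators.\<close>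

lemma card_farey_points_ge:
  assumes "D \<ge> 8" "8 * ln Q \<le> D" "8 * D \<le> real Q"
  shows "(real Q)\<^sup>2 / D\<^sup>2 \<le> card (farey_points (real Q / D) Q)"
proof -
  let ?P = "{q::nat. prime q \<and> real Q / D < real q \<and> q \<le> Q}"
  have Q: "Q \<ge> 64" using assms by linarith
  have lnQ: "ln (real Q) > 0" using Q by simp
  have "4 * (real Q / D) = real Q / (2 * (D / 8))" using assms by (simp add: field_simps)
  also have "\<dots> \<le> real Q / (2 * ln Q)"
    using assms lnQ by (intro divide_left_mono mult_pos_pos) auto
  also have "\<dots> \<le> card {p::nat. prime p \<and> p \<le> Q}" using Q by (intro card_primes_ge) auto
  also have "card {p::nat. prime p \<and> p \<le> Q} \<le> card (?P \<union> {1..nat \<lfloor>real Q / D\<rfloor>})"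
  proof (intro card_mono finite_UnI finite_primes_between subsetI)
    fix p assume "p \<in> {p::nat. prime p \<and> p \<le> Q}"
    then show "p \<in> ?P \<union> {1..nat \<lfloor>real Q / D\<rfloor>}"
      by (cases "real p \<le> real Q / D") (auto intro: le_nat_floor simp: Suc_leI prime_gt_0_nat)
  qed simp
  also have "\<dots> \<le> card ?P + card {1..nat \<lfloor>real Q / D\<rfloor>}" by (rule card_Un_le)
  also have "real \<dots> \<le> real (card ?P) + real Q / D"
    using assms by simp
  finally have P: "3 * (real Q / D) \<le> real (card ?P)" by simp
  have QD: "real Q / D \<ge> 8" using assms by (simp add: field_simps)
  define R where "R = real Q / D"
  have "(real Q)\<^sup>2 / D\<^sup>2 = R * R" unfolding R_def by (simp add: power2_eq_square)
  also have "\<dots> \<le> R * (3 * (R - 1))"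
    using QD unfolding R_def[symmetric] by (intro mult_left_mono) auto
  also have "\<dots> = 3 * (real Q / D) * (real Q / D - 1)" unfolding R_def by (simp add: mult_ac)
  also have "\<dots> \<le> real (card ?P) * (real Q / D - 1)"
    using P QD by (intro mult_right_mono) auto
  also have "\<dots> \<le> (\<Sum>q\<in>?P. real (q - 1))"
    by (rule sum_bounded_below[where K = "real Q / D - 1", THEN order_trans[rotated]] ) auto
  also have "\<dots> = card (farey_points (real Q / D) Q)"
    unfolding farey_points_def by (subst card_SigmaI) (auto simp: finite_primes_between)
  finally show ?thesis .
qed

text \<open>A denominator contributes up to \<open>Q\<close> only if it divides \<open>k\<close>,
  and a nonzero \<open>k\<close> of size at most \<open>Q ^ 4\<close> has at most \<open>D\<close>
  prime divisors. Each other denominator contributes at most 1.\<close>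

lemma norm_farey_exp_sum_le:
  fixes k :: int
  assumes "k \<noteq> 0" "\<bar>k\<bar> \<le> int (Q ^ 4)" "8 * ln Q \<le> D" "Q \<ge> 1"
  shows "norm (\<Sum>(q, a)\<in>farey_points Y Q. ee (- of_int k * (real a / real q))) \<le> real Q * (D + 1)"
proof -
  let ?P = "{q::nat. prime q \<and> Y < real q \<and> q \<le> Q}"
  let ?P' = "{q\<in>?P. int q dvd k}"
  have "2 ^ card ?P' \<le> nat \<bar>k\<bar>"
    by (rule card_prime_divisors_le) (use assms finite_primes_between in \<open>auto simp: dvd_nat_abs_iff\<close>)
  also have "\<dots> \<le> Q ^ 4" using assms by linarith
  finally have "real (2 ^ card ?P') \<le> real (Q ^ 4)" by (simp only: of_nat_le_iff)
  then have "(2::real) ^ card ?P' \<le> real Q ^ 4" by simp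
  then have "ln ((2::real) ^ card ?P') \<le> ln (real Q ^ 4)"
    using assms by (subst ln_le_cancel_iff) auto
  then have "card ?P' * ln 2 \<le> 4 * ln Q" using assms by (simp add: ln_realpow)
  \<comment> \<open>Replacing \<open>ln 2\<close> by 1/2 doubles \<open>4 * ln Q\<close>; this is
    the source of the 8 in \<open>8 * ln Q \<le> D\<close>.\<close>
  moreover have "card ?P' * (1 / 2) \<le> card ?P' * ln (2::real)"
    using ln2_ge_two_thirds by (intro mult_left_mono) auto
  ultimately have P': "real (card ?P') \<le> D" using assms by linarith
  have "(\<Sum>(q, a)\<in>farey_points Y Q. ee (- of_int k * (real a / real q)))
      = (\<Sum>q\<in>?P. \<Sum>a=1..<q. ee (- of_int k * (real a / real q)))"
    unfolding farey_points_def by (subst sum.Sigma) (auto simp: finite_primes_between)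
  also have "norm \<dots> \<le> (\<Sum>q\<in>?P. if int q dvd k then real Q else 1)"
  proof (rule sum_norm_le)
    fix q assume q: "q \<in> ?P"
    then have "norm (\<Sum>a=1..<q. ee (- of_int k * (real a / real q))) \<le> (if int q dvd k then real q else 1)"
      by (intro norm_sum_nontrivial_characters_le) (auto simp: Suc_leI prime_gt_0_nat)
    also have "\<dots> \<le> (if int q dvd k then real Q else 1)" using q by auto
    finally show "norm (\<Sum>a=1..<q. ee (- of_int k * (real a / real q))) \<le> (if int q dvd k then real Q else 1)" .
  qed
  also have "\<dots> \<le> (\<Sum>q\<in>?P. (if int q dvd k then real Q else 0) + 1)" by (intro sum_mono) auto
  also have "\<dots> = real (card ?P') * real Q + real (card ?P)"
    using finite_primes_between by (simp add: sum.distrib sum.If_cases Int_def conj_commute)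
  also have "card ?P \<le> card {1..Q}"
    by (intro card_mono) (auto simp: Suc_leI prime_gt_0_nat)
  also have "real (card ?P') * real Q + real (card {1..Q}) \<le> D * real Q + real Q"
    using P' by (intro add_mono mult_right_mono) auto
  finally show ?thesis by (simp add: algebra_simps)
qed

text \<open>
  The kernel is the average of \<open>cos_kernel L (t - a / q)\<close> over the primes \<open>Q / D < q \<le> Q\<close>
  and \<open>0 < a < q\<close>.  For \<open>L = Q ^ 4\<close> its bumps have width \<open>1 / Q\<^sup>2\<close>, the minimal spacing of the
  fractions, so it is essentially bounded.  Primes make \<open>\<Sum>a. ee (- k a / q)\<close> equal to \<open>- 1\<close>
  unless \<open>q\<close> divides \<open>k\<close>, which happens for few \<open>q\<close>.
\<close>

proposition farey_kernel:
  fixes N Q d :: nat and D :: real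
  assumes N: "N \<ge> 1" and D: "D \<ge> 8" "8 * ln Q \<le> D" and Q: "8 * real N * D \<le> real Q"
    and far: "2 * (real Q)\<^sup>2 * (2 * real N + 1) ^ d \<le> exp (4 * D\<^sup>2)"
  obtains L :: nat and c :: "int \<Rightarrow> complex" and \<Phi> :: "real \<Rightarrow> complex" where
    "c 0 = 1"
    "\<And>t. \<Phi> t = (\<Sum>k=-int L..int L. c k * ee (of_int k * t))"
    "\<And>k. k \<noteq> 0 \<Longrightarrow> \<bar>k\<bar> \<le> int L \<Longrightarrow> norm (c k) \<le> D ^ 4 / real Q"
    "\<And>t. \<exists>w\<ge>0. (\<forall>x. norm (weyl_sum N x t) \<le> w) \<and> norm (\<Phi> t) * w ^ d \<le> D ^ (d + 4) * sqrt (real Q) ^ d"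
proof -
  define S where "S = farey_points (real Q / D) Q"
  define A where "A = real (card S)"
  define L where "L = Q ^ 4"
  define c where "c k = of_real (cos_coeff L k) * ((\<Sum>(q, a)\<in>S. ee (- of_int k * (real a / real q))) / of_real A)" for k
  define \<phi> where "\<phi> t = (\<Sum>(q, a)\<in>S. cos_kernel L (t - real a / real q)) / A" for t
  have "8 * (1 * D) \<le> 8 * (real N * D)" using N D by (intro mult_left_mono mult_right_mono) auto
  then have QD: "8 * D \<le> real Q" using Q by simp
  have Q1: "Q \<ge> 1" "Q \<ge> 64" using QD D by linarith+
  have L: "L \<ge> 1" "sqrt (real L) = (real Q)\<^sup>2" "real L = (real Q)\<^sup>2 * (real Q)\<^sup>2"
    using Q1 unfolding L_def by (auto simp: real_sqrt_unique power_mult[symmetric] power_add[symmetric])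
  have A: "(real Q)\<^sup>2 / D\<^sup>2 \<le> A" unfolding A_def S_def using D QD by (rule card_farey_points_ge)
  moreover have "0 < (real Q)\<^sup>2 / D\<^sup>2" using Q1 D by simp
  ultimately have A0: "A > 0" by linarith
  have finS: "finite S" unfolding S_def by (rule finite_farey_points)
  have \<phi>_nonneg: "\<phi> t \<ge> 0" for t
    unfolding \<phi>_def using A0 by (auto intro!: sum_nonneg divide_nonneg_pos cos_kernel_nonneg)
  show thesis
  proof (rule that[of c "\<lambda>t. of_real (\<phi> t)" L])
    show "c 0 = 1"
      using A0 by (simp add: c_def A_def case_prod_unfold)
    show "complex_of_real (\<phi> t) = (\<Sum>k=-int L..int L. c k * ee (of_int k * t))" for t
    proof -
      have "complex_of_real (\<phi> t) = (\<Sum>z\<in>S. \<Sum>k=-int L..int L. of_real (cos_coeff L k) *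
          ee (of_int k * (t - real (snd z) / real (fst z))) / of_real A)"
        by (simp add: \<phi>_def case_prod_unfold cos_kernel_expansion sum_divide_distrib)
      also have "\<dots> = (\<Sum>k=-int L..int L. \<Sum>z\<in>S. of_real (cos_coeff L k) *
          ee (of_int k * (t - real (snd z) / real (fst z))) / of_real A)"
        by (rule sum.swap)
      also have "\<dots> = (\<Sum>k=-int L..int L. c k * ee (of_int k * t))"
      proof (intro sum.cong refl)
        fix k
        have "ee (of_int k * (t - real (snd z) / real (fst z)))
            = ee (- of_int k * (real (snd z) / real (fst z))) * ee (of_int k * t)" for z :: "nat \<times> nat"
          by (simp only: ee_add[symmetric]) (simp add: algebra_simps)
        then show "(\<Sum>z\<in>S. of_real (cos_coeff L k) * ee (of_int k * (t - real (snd z) / real (fst z))) / of_real A)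
            = c k * ee (of_int k * t)"
          unfolding c_def case_prod_unfold
          by (simp add: sum_distrib_left sum_distrib_right sum_divide_distrib mult.assoc)
      qed
      finally show ?thesis .
    qed
    show "norm (c k) \<le> D ^ 4 / real Q" if k: "k \<noteq> 0" "\<bar>k\<bar> \<le> int L" for k
    proof -
      have s: "norm (\<Sum>(q, a)\<in>S. ee (- of_int k * (real a / real q))) \<le> real Q * (D + 1)"
        unfolding S_def using k D Q1 unfolding L_def by (intro norm_farey_exp_sum_le) auto
      have "norm (c k) \<le> 1 * (real Q * (D + 1) / A)"
        unfolding c_def norm_mult norm_divide norm_of_real
        using s A0 cos_coeff_le_1[of L k] cos_coeff_nonneg[of L k]
        by (intro mult_mono divide_mono) auto
      \<comment> \<open>The gain comes from the normalisation: an exponential sum of size about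
        \<open>Q\<close> is divided by about \<open>Q\<^sup>2\<close> fractions.\<close>
      also have "\<dots> \<le> real Q * (D + 1) / ((real Q)\<^sup>2 / D\<^sup>2)"
        unfolding mult_1 using A A0 Q1 D by (intro frac_le) auto
      also have "\<dots> = (D + 1) * D\<^sup>2 / real Q"
        using Q1 D by (simp add: power2_eq_square field_simps)
      also have "\<dots> \<le> D\<^sup>2 * D\<^sup>2 / real Q"
      proof -
        have "8 * D \<le> D * D" using D by (intro mult_right_mono) auto
        then have "D + 1 \<le> D * D" using D by linarith
        then show ?thesis unfolding power2_eq_square[of D]
          using D by (intro divide_right_mono mult_right_mono) auto
      qed
      finally show ?thesis by (simp add: power_add[symmetric])
    qed
    show "\<exists>w\<ge>0. (\<forall>x. norm (weyl_sum N x t) \<le> w) \<and>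
        norm (complex_of_real (\<phi> t)) * w ^ d \<le> D ^ (d + 4) * sqrt (real Q) ^ d" for t
    proof -
      \<comment> \<open>\<open>D\<close> times the width of a bump. With \<open>L = Q ^ 4\<close>
        the decay exponent \<open>4 * \<delta>\<^sup>2 * L\<close> becomes
        \<open>4 * D\<^sup>2\<close>, as in \<open>far\<close>.\<close>
      define \<delta> where "\<delta> = D / (real Q)\<^sup>2"
      define near where "near = {(q, a) \<in> S. \<exists>k::int. \<bar>t - real a / real q - of_int k\<bar> \<le> \<delta>}"
      have near: "near \<subseteq> S" unfolding near_def by auto
      have \<delta>: "\<delta> > 0" using D Q1 unfolding \<delta>_def by simp
      have card_near: "real (card near) \<le> 2 * D + 2"
        using card_farey_points_near_le[of \<delta> Q "real Q / D" t] \<delta> Q1 unfolding near_def S_def \<delta>_def by simp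
      \<comment> \<open>A bound for the bump of any fraction farther than \<delta> from
        \<open>t\<close>, hence also for the contribution of all of them to the average.\<close>
      define E where "E = 2 * (real Q)\<^sup>2 * exp (- 4 * D\<^sup>2)"
      have E: "E * (2 * real N + 1) ^ d \<le> 1"
        using far unfolding E_def by (simp add: exp_minus field_simps)
      have \<phi>_le: "\<phi> t \<le> real (card near) * (2 * (real Q)\<^sup>2) / A + E"
      proof -
        have "(\<Sum>(q, a)\<in>S. cos_kernel L (t - real a / real q))
            = (\<Sum>(q, a)\<in>S - near. cos_kernel L (t - real a / real q)) + (\<Sum>(q, a)\<in>near. cos_kernel L (t - real a / real q))"
          using finS near by (rule sum.subset_diff[rotated])
        also have "\<dots> \<le> A * E + real (card near) * (2 * (real Q)\<^sup>2)"
        proof (rule add_mono)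
          have "(\<Sum>(q, a)\<in>S - near. cos_kernel L (t - real a / real q)) \<le> real (card (S - near)) * E"
          proof (rule sum_bounded_above, clarify)
            fix q a assume "(q, a) \<in> S" "(q, a) \<notin> near"
            then have "\<delta> \<le> \<bar>t - real a / real q - of_int k\<bar>" for k :: int
              unfolding near_def by (auto simp: not_le intro: less_imp_le)
            then have "cos_kernel L (t - real a / real q) \<le> 2 * sqrt L * exp (- 4 * \<delta>\<^sup>2 * L)"
              using L(1) \<delta> by (intro cos_kernel_decay) auto
            also have "- 4 * \<delta>\<^sup>2 * L = - 4 * D\<^sup>2"
              unfolding L(3) \<delta>_def using Q1 by (simp add: power_divide power2_eq_square)
            finally show "cos_kernel L (t - real a / real q) \<le> E" unfolding E_def L(2) .
          qed
          also have "\<dots> \<le> A * E"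
            unfolding A_def E_def using finS by (intro mult_right_mono) (auto intro!: card_mono)
          finally show "(\<Sum>(q, a)\<in>S - near. cos_kernel L (t - real a / real q)) \<le> A * E" .
          show "(\<Sum>(q, a)\<in>near. cos_kernel L (t - real a / real q)) \<le> real (card near) * (2 * (real Q)\<^sup>2)"
            by (rule sum_bounded_above) (use cos_kernel_le[OF L(1)] L(2) in auto)
        qed
        finally show ?thesis unfolding \<phi>_def using A0 by (simp add: field_simps)
      qed
      show ?thesis
      proof (cases "near = {}")
        case True
        \<comment> \<open>With no fraction near \<open>t\<close> only the tail \<open>E\<close>
          remains; it is small enough to pay for the trivial bound on the Weyl sum.\<close>
        have "\<phi> t * (2 * real N + 1) ^ d \<le> E * (2 * real N + 1) ^ d"
          using \<phi>_le True by (intro mult_right_mono) auto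
        also have "\<dots> \<le> 1" by (rule E)
        finally have "\<phi> t * (2 * real N + 1) ^ d \<le> 1" .
        moreover have "1 * 1 \<le> D ^ (d + 4) * sqrt (real Q) ^ d"
          using D Q1 by (intro mult_mono one_le_power) auto
        ultimately have "\<phi> t * (2 * real N + 1) ^ d \<le> D ^ (d + 4) * sqrt (real Q) ^ d" by simp
        then show ?thesis
          using norm_weyl_sum_le \<phi>_nonneg by (intro exI[of _ "2 * real N + 1"]) auto
      next
        case False
        then obtain q a k where qa: "(q, a) \<in> S" and k: "\<bar>t - real a / real q - of_int k\<bar> \<le> \<delta>"
          unfolding near_def by blast
        have q: "prime q" "real Q / D < real q" "q \<le> Q" "0 < a" "a < q"
          using qa unfolding S_def farey_points_def by auto
        have "8 * real N \<le> real Q / D" using Q D by (simp add: field_simps)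
        then have qN: "4 * N < q" using q(2) N by linarith
        \<comment> \<open>The condition \<open>8 * N * D \<le> Q\<close> places \<open>t\<close>
          within the range of Weyl's inequality around \<open>a / q\<close>; it also gave
          \<open>4 * N < q\<close>.\<close>
        have "\<delta> = (8 * real N * D) / (8 * real N * (real Q)\<^sup>2)"
          unfolding \<delta>_def using N by simp
        also have "\<dots> \<le> real Q / (8 * real N * (real Q)\<^sup>2)"
          using Q by (intro divide_right_mono) auto
        also have "\<dots> = 1 / (8 * real N * real Q)" using Q1 N by (simp add: power2_eq_square)
        also have "\<dots> \<le> 1 / (8 * real N * real q)"
          using q N by (intro divide_left_mono mult_left_mono mult_pos_pos) auto
        finally have k': "\<bar>t - real a / real q - of_int k\<bar> \<le> 1 / (8 * real N * real q)"
          using k by linarith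
        \<comment> \<open>The root of Weyl's bound, with \<open>q\<close> replaced by
          \<open>Q\<close> and \<open>2 + ln q\<close> by \<open>D\<close>.\<close>
        define w where "w = sqrt (2 * D * real Q)"
        have W: "norm (weyl_sum N x t) \<le> w" for x
        proof -
          have "(norm (weyl_sum N x t))\<^sup>2 \<le> 2 * real q * (2 + ln q)"
            by (rule weyl_bound[of q N "int a" t k]) (use q qN N k' in auto)
          also have "\<dots> \<le> 2 * real Q * D"
          proof (intro mult_mono)
            have "ln (real q) \<le> ln (real Q)" using q by (subst ln_le_cancel_iff) auto
            then show "2 + ln (real q) \<le> D" using D by linarith
          qed (use q in auto)
          finally show ?thesis unfolding w_def by (intro real_le_rsqrt) (simp add: mult_ac)
        qed
        \<comment> \<open>At most \<open>2 * D + 2\<close> bumps of height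
          \<open>2 * Q\<^sup>2\<close> matter, and they are averaged over at least
          \<open>Q\<^sup>2 / D\<^sup>2\<close> fractions.\<close>
        have "\<phi> t \<le> D ^ 4"
        proof -
          have "real (card near) * (2 * (real Q)\<^sup>2) / A \<le> (2 * D + 2) * (2 * (real Q)\<^sup>2) / ((real Q)\<^sup>2 / D\<^sup>2)"
            using card_near A A0 Q1 D by (intro frac_le mult_right_mono) auto
          also have "\<dots> = (4 * D + 4) * D\<^sup>2" using Q1 D by simp
          finally have 1: "real (card near) * (2 * (real Q)\<^sup>2) / A \<le> (4 * D + 4) * D\<^sup>2" .
          have "E * 1 \<le> E * (2 * real N + 1) ^ d"
            unfolding E_def by (intro mult_left_mono one_le_power) auto
          then have "E \<le> 1" using E by linarith
          moreover have "1 \<le> D\<^sup>2" using D by (intro one_le_power) auto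
          ultimately have "\<phi> t \<le> (4 * D + 5) * D\<^sup>2" using \<phi>_le 1 by (simp add: algebra_simps)
          also have "\<dots> \<le> (D * D) * D\<^sup>2"
          proof (rule mult_right_mono)
            have "8 * D \<le> D * D" using D by (intro mult_right_mono) auto
            then show "4 * D + 5 \<le> D * D" using D by linarith
          qed simp
          finally show ?thesis by (simp add: power_numeral_reduce mult_ac)
        qed
        moreover have "w ^ d \<le> D ^ d * sqrt (real Q) ^ d"
        proof -
          have "2 * D \<le> D\<^sup>2" unfolding power2_eq_square using D by (intro mult_right_mono) auto
          then have "w \<le> sqrt (D\<^sup>2 * real Q)" unfolding w_def by (intro real_sqrt_le_mono mult_right_mono) auto
          also have "\<dots> = D * sqrt (real Q)" using D by (simp add: real_sqrt_mult)
          finally have "w ^ d \<le> (D * sqrt (real Q)) ^ d"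
            using D unfolding w_def by (intro power_mono) auto
          then show ?thesis by (simp add: power_mult_distrib)
        qed
        ultimately have "\<phi> t * w ^ d \<le> D ^ 4 * (D ^ d * sqrt (real Q) ^ d)"
          using D \<phi>_nonneg unfolding w_def by (intro mult_mono) auto
        then show ?thesis
          using W \<phi>_nonneg D unfolding w_def by (intro exI[of _ w]) (auto simp: w_def power_add mult_ac)
      qed
    qed
  qed
qed

section \<open>The level set estimate\<close>

lemma borel_measurable_ee [measurable]: "ee \<in> borel_measurable borel"
  unfolding ee_def by (intro borel_measurable_continuous_onI continuous_intros)

lemma borel_measurable_cnj [measurable]: "cnj \<in> borel_measurable borel"
  by (intro borel_measurable_continuous_onI continuous_intros)

lemma integral_torus_ee: "(\<integral>x. ee (of_int k * x) \<partial>torus) = (if k = 0 then 1 else 0)"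
proof (cases "k = 0")
  case True
  interpret prob_space torus by (rule prob_space_torus)
  show ?thesis using True by (simp add: prob_space)
next
  case False
  define F where "F x = ee (of_int k * x) / (2 * of_real pi * \<i> * of_int k)" for x
  have "(F has_vector_derivative ee (of_int k * x)) (at x within {0..1})" for x
    unfolding F_def ee_def cis_conv_exp using False
    by (auto intro!: derivative_eq_intros has_vector_derivative_real_field simp: field_simps)
  then have I: "(\<integral>x. indicator {0..1} x *\<^sub>R ee (of_int k * x) \<partial>lborel) = F 1 - F 0"
    by (intro integral_FTC_atLeastAtMost) (auto simp: ee_def intro!: continuous_intros)
  have "(\<integral>x. ee (of_int k * x) \<partial>torus) = (\<integral>x. indicator {0..<1} x *\<^sub>R ee (of_int k * x) \<partial>lborel)"
    unfolding torus_def by (intro integral_restrict_space) simp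
  \<comment> \<open>The fundamental theorem of calculus wants the closed interval; the added
    endpoint is a null set.\<close>
  also have "\<dots> = (\<integral>x. indicator {0..1} x *\<^sub>R ee (of_int k * x) \<partial>lborel)"
  proof (rule integral_cong_AE)
    show "AE x in lborel. indicator {0..<1} x *\<^sub>R ee (of_int k * x) = indicator {0..1} x *\<^sub>R ee (of_int k * x)"
      using AE_lborel_singleton[of "1::real"] by eventually_elim (auto simp: indicator_def)
  qed measurable
  also have "\<dots> = 0"
    unfolding I F_def using ee_of_int[of k] by simp
  finally show ?thesis using False by simp
qed

text \<open>The time frequency \<open>m\<close> is not tied to the paraboloid, because multiplying
  the kernel by a polynomial in \<open>t\<close> shifts it.\<close>

definition mode :: "nat \<Rightarrow> (nat \<Rightarrow> int) \<Rightarrow> int \<Rightarrow> (nat \<Rightarrow> real) \<times> real \<Rightarrow> complex" where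
  "mode d n m z = ee ((\<Sum>j<d. of_int (n j) * fst z j) + of_int m * snd z)"

lemma norm_mode [simp]: "norm (mode d n m z) = 1"
  by (simp add: mode_def)

lemma borel_measurable_mode [measurable]: "mode d n m \<in> borel_measurable (torus_st d)"
proof -
  have [measurable]: "(\<lambda>x. x) \<in> borel_measurable torus"
    unfolding torus_def by (intro measurable_restrict_space1) simp
  have [measurable]: "(\<lambda>z. snd z) \<in> borel_measurable (torus_st d)"
    unfolding torus_st_def by measurable
  have [measurable]: "(\<lambda>z. fst z j) \<in> borel_measurable (torus_st d)" if "j < d" for j
  proof -
    have "(\<lambda>x. x j) \<in> measurable (\<Pi>\<^sub>M j\<in>{..<d}. torus) torus"
      using that by (intro measurable_component_singleton) auto
    then show ?thesis
      unfolding torus_st_def by measurable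
  qed
  have [measurable]: "(\<lambda>z. \<Sum>j<d. of_int (n j) * fst z j) \<in> borel_measurable (torus_st d)"
    by (intro borel_measurable_sum borel_measurable_times) auto
  show ?thesis unfolding mode_def by measurable
qed

lemma mode_times_cnj_mode: "mode d n m z * cnj (mode d n' m' z) = mode d (\<lambda>j. n j - n' j) (m - m') z"
  by (simp add: mode_def cnj_ee ee_add[symmetric] sum_subtractf algebra_simps)

lemma integral_mode:
  "(\<integral>z. mode d n m z \<partial>torus_st d) = (if (\<forall>j<d. n j = 0) \<and> m = 0 then 1 else 0)"
proof -
  interpret T: prob_space torus by (rule prob_space_torus)
  interpret P: product_prob_space "\<lambda>_. torus" "{..<d}" by unfold_locales
  interpret Q: pair_prob_space "\<Pi>\<^sub>M j\<in>{..<d}. torus" torus by unfold_locales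
  have "(\<lambda>x. ee (of_int k * x)) \<in> borel_measurable torus" for k
    unfolding torus_def by (intro measurable_restrict_space1) measurable
  then have int: "integrable torus (\<lambda>x. ee (of_int k * x))" for k
    by (intro T.integrable_const_bound[where B = 1]) auto
  interpret ST: prob_space "torus_st d" by (rule prob_space_torus_st)
  have "integrable (torus_st d) (mode d n m)"
    by (rule ST.integrable_const_bound[where B = 1]) auto
  then have "(\<integral>z. mode d n m z \<partial>torus_st d) = (\<integral>x. (\<integral>t. mode d n m (x, t) \<partial>torus) \<partial>(\<Pi>\<^sub>M j\<in>{..<d}. torus))"
    unfolding torus_st_def by (rule Q.integral_fst'[symmetric])
  also have "\<dots> = (\<integral>x. (\<Prod>j<d. ee (of_int (n j) * x j)) * (\<integral>t. ee (of_int m * t) \<partial>torus) \<partial>(\<Pi>\<^sub>M j\<in>{..<d}. torus))"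
    by (simp add: mode_def ee_add ee_sum)
  also have "\<dots> = (\<Prod>j<d. \<integral>x. ee (of_int (n j) * x) \<partial>torus) * (\<integral>t. ee (of_int m * t) \<partial>torus)"
    using P.product_integral_prod[of "{..<d}" "\<lambda>j x. ee (of_int (n j) * x)"] int by simp
  also have "\<dots> = (if (\<forall>j<d. n j = 0) \<and> m = 0 then 1 else 0)"
    unfolding integral_torus_ee by (auto simp: prod_zero_iff intro!: prod.neutral)
  finally show ?thesis .
qed

lemma mode_orthonormal:
  assumes "n \<in> freqs d N" "n' \<in> freqs d N"
  shows "(\<integral>z. mode d n m z * cnj (mode d n' m' z) \<partial>torus_st d) = (if n = n' \<and> m = m' then 1 else 0)"
proof -
  \<comment> \<open>Members of \<open>freqs d N\<close> are \<open>undefined\<close> from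
    \<open>d\<close> on, so agreement below \<open>d\<close> is equality.\<close>
  have "(\<forall>j<d. n j - n' j = 0) \<longleftrightarrow> n = n'"
    using assms unfolding freqs_def by (auto intro!: PiE_ext[of n "{..<d}" _ n'])
  then show ?thesis unfolding mode_times_cnj_mode integral_mode by auto
qed

text \<open>With \<open>g\<close> the orthogonal projection of \<open>f\<close> onto the span of the
  \<open>e i\<close>, the nonnegative integral of \<open>(norm (f z - g z))\<^sup>2\<close> is the
  right side minus the left. The uniform bounds make all products integrable.\<close>

lemma (in prob_space) bessel_inequality:
  fixes f :: "'a \<Rightarrow> complex" and e :: "'i \<Rightarrow> 'a \<Rightarrow> complex"
  assumes "finite I" and f[measurable]: "f \<in> borel_measurable M" and fB: "\<And>z. norm (f z) \<le> B"
    and e[measurable]: "\<And>i. e i \<in> borel_measurable M" and e1: "\<And>i z. norm (e i z) \<le> 1"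
    and orth: "\<And>i j. i \<in> I \<Longrightarrow> j \<in> I \<Longrightarrow> (\<integral>z. e i z * cnj (e j z) \<partial>M) = (if i = j then 1 else 0)"
  shows "(\<Sum>i\<in>I. (norm (\<integral>z. f z * cnj (e i z) \<partial>M))\<^sup>2) \<le> (\<integral>z. (norm (f z))\<^sup>2 \<partial>M)"
proof -
  define c where "c i = (\<integral>z. f z * cnj (e i z) \<partial>M)" for i
  define g where "g z = (\<Sum>i\<in>I. c i * e i z)" for z
  define s where "s = (\<Sum>i\<in>I. (norm (c i))\<^sup>2)"
  have B0: "B \<ge> 0" using fB norm_ge_zero order_trans by blast
  have [measurable]: "g \<in> borel_measurable M" unfolding g_def by measurable
  have gB: "norm (g z) \<le> (\<Sum>i\<in>I. norm (c i))" for z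
    unfolding g_def using e1 by (intro sum_norm_le) (simp add: norm_mult mult_left_le)
  have int_fe: "integrable M (\<lambda>z. f z * cnj (e i z))" for i
    by (rule integrable_const_bound[where B = "B * 1"], rule AE_I2, unfold norm_mult, rule mult_mono)
       (simp_all add: fB e1 B0)
  have int_ee: "integrable M (\<lambda>z. e i z * cnj (e j z))" for i j
    by (rule integrable_const_bound[where B = "1 * 1"])
       (auto simp: norm_mult intro!: AE_I2 mult_le_one e1)
  have int_f: "integrable M (\<lambda>z. f z * cnj (f z))"
    by (rule integrable_const_bound[where B = "B * B"])
       (auto simp: norm_mult intro!: AE_I2 mult_mono fB B0)
  have fg: "f z * cnj (g z) = (\<Sum>i\<in>I. cnj (c i) * (f z * cnj (e i z)))" for z
    unfolding g_def by (simp add: sum_distrib_left mult_ac)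
  have gg: "g z * cnj (g z) = (\<Sum>i\<in>I. \<Sum>j\<in>I. c i * cnj (c j) * (e i z * cnj (e j z)))" for z
    unfolding g_def by (simp add: sum_product mult_ac)
  have int_fg: "integrable M (\<lambda>z. f z * cnj (g z))"
    unfolding fg by (intro Bochner_Integration.integrable_sum integrable_mult_right int_fe)
  have int_gg: "integrable M (\<lambda>z. g z * cnj (g z))"
    unfolding gg by (intro Bochner_Integration.integrable_sum integrable_mult_right int_ee)
  have int_gf: "integrable M (\<lambda>z. cnj (f z * cnj (g z)))"
    using int_fg by (simp only: complex_integrable_cnj)
  have FG: "(\<integral>z. f z * cnj (g z) \<partial>M) = of_real s"
    unfolding fg s_def using int_fe
    by (simp add: c_def[symmetric] mult.commute)
       (simp only: complex_norm_square of_real_power[symmetric])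
  have GG: "(\<integral>z. g z * cnj (g z) \<partial>M) = of_real s"
  proof -
    have "(\<integral>z. g z * cnj (g z) \<partial>M) = (\<Sum>i\<in>I. \<Sum>j\<in>I. c i * cnj (c j) * (\<integral>z. e i z * cnj (e j z) \<partial>M))"
      unfolding gg using int_ee by simp
    also have "\<dots> = (\<Sum>i\<in>I. \<Sum>j\<in>I. if i = j then c i * cnj (c j) else 0)"
      using orth by (intro sum.cong refl) auto
    also have "\<dots> = (\<Sum>i\<in>I. c i * cnj (c i))" using \<open>finite I\<close> by simp
    finally show ?thesis unfolding s_def of_real_sum complex_norm_square .
  qed
  have GF: "(\<integral>z. cnj (f z * cnj (g z)) \<partial>M) = of_real s"
    by (rule trans[OF Bochner_Integration.integral_cnj]) (simp add: FG)
  have exp: "of_real ((norm (f z - g z))\<^sup>2)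
      = (f z * cnj (f z) - f z * cnj (g z)) - (cnj (f z * cnj (g z)) - g z * cnj (g z))" for z
    unfolding complex_norm_square by (simp add: algebra_simps)
  have "complex_of_real (\<integral>z. (norm (f z - g z))\<^sup>2 \<partial>M) = (\<integral>z. of_real ((norm (f z - g z))\<^sup>2) \<partial>M)"
    by (rule integral_complex_of_real[symmetric])
  also have "\<dots> = (\<integral>z. f z * cnj (f z) \<partial>M) - of_real s"
    unfolding exp using int_f int_fg int_gg int_gf
    by (simp add: FG GG GF del: complex_cnj_mult)
  also have "(\<integral>z. f z * cnj (f z) \<partial>M) = of_real (\<integral>z. (norm (f z))\<^sup>2 \<partial>M)"
    by (simp only: complex_norm_square[symmetric] integral_complex_of_real)
  finally have "complex_of_real (\<integral>z. (norm (f z - g z))\<^sup>2 \<partial>M) = of_real ((\<integral>z. (norm (f z))\<^sup>2 \<partial>M) - s)"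
    by simp
  then have "(\<integral>z. (norm (f z - g z))\<^sup>2 \<partial>M) = (\<integral>z. (norm (f z))\<^sup>2 \<partial>M) - s"
    by (simp only: of_real_eq_iff)
  moreover have "(\<integral>z. (norm (f z - g z))\<^sup>2 \<partial>M) \<ge> 0" by simp
  ultimately show ?thesis unfolding s_def c_def by linarith
qed

section \<open>From the kernel to level sets\<close>

lemma schroedinger_sum_eq:
  "schroedinger_sum d N a z = (\<Sum>n\<in>freqs d N. a n * mode d n (\<Sum>j<d. (n j)\<^sup>2) z)"
  by (cases z) (simp add: schroedinger_sum_def mode_def ee_def cis_conv_exp mult_ac)

text \<open>The shift \<open>k\<close> only contributes a character in time, and a sum of products
  over a box of frequencies is a product of one-dimensional Weyl sums.\<close>

lemma kernel_factorization:
  "(\<Sum>n\<in>freqs d N. mode d n ((\<Sum>j<d. (n j)\<^sup>2) + k) z * cnj (mode d n ((\<Sum>j<d. (n j)\<^sup>2) + k) w))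
    = ee (of_int k * (snd z - snd w)) * (\<Prod>j<d. weyl_sum N (fst z j - fst w j) (snd z - snd w))"
proof -
  let ?\<tau> = "snd z - snd w" and ?y = "\<lambda>j. fst z j - fst w j"
  have "mode d n ((\<Sum>j<d. (n j)\<^sup>2) + k) z * cnj (mode d n ((\<Sum>j<d. (n j)\<^sup>2) + k) w)
      = ee (of_int k * ?\<tau>) * (\<Prod>j<d. ee (of_int (n j) * ?y j + (of_int (n j))\<^sup>2 * ?\<tau>))" for n
    unfolding mode_def cnj_ee ee_add[symmetric] ee_sum[OF finite_lessThan, symmetric]
    by (intro arg_cong[of _ _ ee])
       (simp add: sum.distrib sum_subtractf sum_distrib_left sum_distrib_right algebra_simps)
  then have "(\<Sum>n\<in>freqs d N. mode d n ((\<Sum>j<d. (n j)\<^sup>2) + k) z * cnj (mode d n ((\<Sum>j<d. (n j)\<^sup>2) + k) w))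
      = ee (of_int k * ?\<tau>) * (\<Sum>n\<in>freqs d N. \<Prod>j<d. ee (of_int (n j) * ?y j + (of_int (n j))\<^sup>2 * ?\<tau>))"
    by (simp add: sum_distrib_left)
  also have "{n. \<bar>n\<bar> \<le> int N} = {- int N..int N}" by auto
  then have "(\<Sum>n\<in>freqs d N. \<Prod>j<d. ee (of_int (n j) * ?y j + (of_int (n j))\<^sup>2 * ?\<tau>))
      = (\<Prod>j<d. weyl_sum N (?y j) ?\<tau>)"
    unfolding weyl_sum_def freqs_def by (subst prod_sum_PiE) auto
  finally show ?thesis .
qed


text \<open>The quadratic form of the kernel times \<Phi> is bounded pointwise by \<open>B\<close>.
  Its zero shift is the form that controls the level set, and Bessel's inequality bounds the other
  shifts by \<open>\<beta> * \<mu>\<close>.\<close>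

proposition level_set_estimate:
  fixes c :: "int \<Rightarrow> complex" and \<Phi> :: "real \<Rightarrow> complex" and \<beta> B \<alpha> :: real
  assumes c0: "c 0 = 1"
    and \<Phi>: "\<And>t. \<Phi> t = (\<Sum>k=-int L..int L. c k * ee (of_int k * t))"
    and c\<beta>: "\<And>k. k \<noteq> 0 \<Longrightarrow> \<bar>k\<bar> \<le> int L \<Longrightarrow> norm (c k) \<le> \<beta>" and "\<beta> \<ge> 0"
    and W: "\<And>t. \<exists>w\<ge>0. (\<forall>x. norm (weyl_sum N x t) \<le> w) \<and> norm (\<Phi> t) * w ^ d \<le> B"
    and a: "l2_norm d N a = 1" and "\<alpha> > 0"
  defines "\<mu> \<equiv> measure (torus_st d) {z \<in> space (torus_st d). \<alpha> < norm (schroedinger_sum d N a z)}"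
  shows "\<alpha>\<^sup>2 * \<mu>\<^sup>2 \<le> B * \<mu>\<^sup>2 + \<beta> * \<mu>"
proof -
  interpret prob_space "torus_st d" by (rule prob_space_torus_st)
  let ?M = "torus_st d" and ?F = "schroedinger_sum d N a"
  let ?K = "{-int L..int L}" and ?S = "freqs d N"
  define E where "E = {z \<in> space ?M. \<alpha> < norm (?F z)}"
  have [measurable]: "E \<in> sets ?M" unfolding E_def by measurable
  have E: "prob E = \<mu>" "E \<inter> space ?M = E"
    by (auto simp: \<mu>_def E_def)
  define sq where "sq n = (\<Sum>j<d. (n j)\<^sup>2)" for n :: "nat \<Rightarrow> int"
  define f where "f z = indicator E z * (?F z / of_real (norm (?F z)))" for z
  have [measurable]: "f \<in> borel_measurable ?M" unfolding f_def by measurable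
  have norm_f: "norm (f z) = indicator E z" if "z \<in> space ?M" for z
    using that \<open>\<alpha> > 0\<close> unfolding f_def E_def by (auto simp: indicator_def norm_divide)
  have f1: "norm (f z) \<le> 1" for z
    unfolding f_def by (auto simp: indicator_def norm_divide)
  define fh where "fh n m = (\<integral>z. f z * cnj (mode d n m z) \<partial>?M)" for n m
  have int_f: "integrable ?M (\<lambda>z. f z * cnj (mode d n m z))" for n m
    by (rule integrable_const_bound[where B = 1]) (auto simp: norm_mult f1)
  have int_f': "integrable ?M (\<lambda>z. mode d n m z * cnj (f z))" for n m
    by (rule integrable_const_bound[where B = 1]) (auto simp: norm_mult f1)
  have cnj_fh: "cnj (fh n m) = (\<integral>z. mode d n m z * cnj (f z) \<partial>?M)" for n m
  proof -
    have "cnj (fh n m) = (\<integral>z. cnj (f z * cnj (mode d n m z)) \<partial>?M)"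
      unfolding fh_def by (rule Bochner_Integration.integral_cnj[symmetric])
    then show ?thesis by (simp only: complex_cnj_mult complex_cnj_cnj mult.commute)
  qed
  have int_norm_f: "(\<integral>z. norm (f z) \<partial>?M) = \<mu>"
  proof -
    have "(\<integral>z. norm (f z) \<partial>?M) = (\<integral>z. indicator E z \<partial>?M)"
      by (intro Bochner_Integration.integral_cong refl norm_f)
    then show ?thesis by (simp add: E)
  qed
  have int_norm_f2: "(\<integral>z. (norm (f z))\<^sup>2 \<partial>?M) = \<mu>"
  proof -
    have "(\<integral>z. (norm (f z))\<^sup>2 \<partial>?M) = (\<integral>z. norm (f z) \<partial>?M)"
      by (intro Bochner_Integration.integral_cong refl) (simp add: norm_f indicator_def)
    then show ?thesis using int_norm_f by simp
  qed

  define G where "G = (\<Sum>n\<in>?S. (norm (fh n (sq n)))\<^sup>2)"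
  \<comment> \<open>Pairing the sum with its own phase recovers its modulus on \<open>E\<close>;
    Cauchy-Schwarz against the unit vector \<open>a\<close> then gives \<open>G\<close>.\<close>
  have dual: "\<alpha>\<^sup>2 * \<mu>\<^sup>2 \<le> G"
  proof -
    have int_F: "integrable ?M (\<lambda>z. ?F z * cnj (f z))"
      unfolding schroedinger_sum_eq sum_distrib_right mult.assoc
      by (intro Bochner_Integration.integrable_sum integrable_mult_right int_f')
    have "?F z * cnj (f z) = of_real (indicator E z * norm (?F z))" for z
      unfolding f_def
      by (cases "?F z = 0") (auto simp: indicator_def complex_norm_square[symmetric] power2_eq_square field_simps)
    then have eq: "indicator E z * norm (?F z) = Re (?F z * cnj (f z))" for z
      by (metis Re_complex_of_real)
    have "\<alpha> * \<mu> = (\<integral>z. \<alpha> * indicator E z \<partial>?M)" by (simp add: E)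
    also have "\<dots> \<le> (\<integral>z. indicator E z * norm (?F z) \<partial>?M)"
    proof (rule integral_mono)
      show "integrable ?M (\<lambda>z. indicator E z * norm (?F z))"
        unfolding eq using int_F by (rule integrable_Re)
      show "\<alpha> * indicator E z \<le> indicator E z * norm (?F z)" for z
        by (auto simp: indicator_def E_def)
    qed (auto intro!: integrable_mult_right simp: less_top[symmetric])
    also have "\<dots> = Re (\<integral>z. ?F z * cnj (f z) \<partial>?M)"
      unfolding eq using int_F by (rule Bochner_Integration.integral_Re)
    also have "(\<integral>z. ?F z * cnj (f z) \<partial>?M) = (\<Sum>n\<in>?S. a n * cnj (fh n (sq n)))"
      unfolding schroedinger_sum_eq sum_distrib_right mult.assoc cnj_fh sq_def using int_f' by simp
    also have "Re \<dots> \<le> norm (\<Sum>n\<in>?S. a n * cnj (fh n (sq n)))" by (rule complex_Re_le_cmod)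
    also have "\<dots> \<le> (\<Sum>n\<in>?S. norm (a n) * norm (fh n (sq n)))"
      by (rule order_trans[OF norm_sum]) (simp add: norm_mult)
    finally have "(\<alpha> * \<mu>)\<^sup>2 \<le> (\<Sum>n\<in>?S. norm (a n) * norm (fh n (sq n)))\<^sup>2"
      using \<open>\<alpha> > 0\<close> by (intro power_mono) (auto simp: \<mu>_def)
    also have "\<dots> \<le> (\<Sum>n\<in>?S. (norm (a n))\<^sup>2) * G"
      unfolding G_def by (rule Cauchy_Schwarz_ineq_sum)
    also have "(\<Sum>n\<in>?S. (norm (a n))\<^sup>2) = 1" using a unfolding l2_norm_def by simp
    finally show ?thesis by (simp add: power_mult_distrib)
  qed

  \<comment> \<open>The Fourier form of the convolution of \<open>f\<close> with the modified
    kernel; \<open>V\<close> below is that kernel in physical space.\<close>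
  define H where "H w = (\<Sum>n\<in>?S. \<Sum>k\<in>?K. c k * fh n (sq n + k) * mode d n (sq n + k) w)" for w
  have H: "norm (H w) \<le> B * \<mu>" for w
  proof -
    define V where "V z = (\<Sum>n\<in>?S. \<Sum>k\<in>?K. c k * mode d n (sq n + k) w * cnj (mode d n (sq n + k) z))" for z
    have V: "V z = \<Phi> (snd w - snd z) * (\<Prod>j<d. weyl_sum N (fst w j - fst z j) (snd w - snd z))" for z
    proof -
      have "V z = (\<Sum>k\<in>?K. c k * (\<Sum>n\<in>?S. mode d n (sq n + k) w * cnj (mode d n (sq n + k) z)))"
        unfolding V_def by (subst sum.swap) (simp add: sum_distrib_left mult.assoc)
      then show ?thesis
        unfolding sq_def kernel_factorization \<Phi> by (simp add: sum_distrib_right mult.assoc)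
    qed
    have VB: "norm (V z) \<le> B" for z
    proof -
      obtain u where u: "u \<ge> 0" "\<And>x. norm (weyl_sum N x (snd w - snd z)) \<le> u"
        "norm (\<Phi> (snd w - snd z)) * u ^ d \<le> B" using W by blast
      have "norm (V z) = norm (\<Phi> (snd w - snd z)) * (\<Prod>j<d. norm (weyl_sum N (fst w j - fst z j) (snd w - snd z)))"
        unfolding V norm_mult prod_norm ..
      also have "\<dots> \<le> norm (\<Phi> (snd w - snd z)) * (\<Prod>j<d. u)"
        using u by (intro mult_left_mono prod_mono) auto
      finally show ?thesis using u by simp
    qed
    have "H w = (\<integral>z. f z * V z \<partial>?M)"
    proof -
      have "(\<integral>z. f z * V z \<partial>?M) = (\<integral>z. (\<Sum>n\<in>?S. \<Sum>k\<in>?K. (c k * mode d n (sq n + k) w) * (f z * cnj (mode d n (sq n + k) z))) \<partial>?M)"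
        unfolding V_def by (simp add: sum_distrib_left mult_ac)
      also have "\<dots> = (\<Sum>n\<in>?S. \<Sum>k\<in>?K. (c k * mode d n (sq n + k) w) * fh n (sq n + k))"
        using int_f by (simp add: fh_def)
      finally show ?thesis unfolding H_def by (simp add: mult_ac)
    qed
    also have "norm \<dots> \<le> (\<integral>z. norm (f z) * B \<partial>?M)"
    proof (rule order_trans[OF Bochner_Integration.integral_norm_bound], rule Bochner_Integration.integral_mono')
      show "integrable ?M (\<lambda>z. norm (f z) * B)"
        by (intro integrable_mult_left integrable_const_bound[where B = 1]) (auto simp: f1)
      show "norm (f z * V z) \<le> norm (f z) * B" for z
        unfolding norm_mult using VB by (intro mult_left_mono) auto
      have "0 \<le> B" using VB[of w] norm_ge_zero order_trans by blast
      then show "0 \<le> norm (f z) * B" for z by simp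
    qed
    also have "\<dots> = B * \<mu>" using int_norm_f by simp
    finally show ?thesis .
  qed
  \<comment> \<open>Pairing \<open>H\<close> with \<open>f\<close> turns the pointwise bound on
    \<open>H\<close> into a bound for the weighted sum of squared coefficients.\<close>
  have main: "norm (\<Sum>n\<in>?S. \<Sum>k\<in>?K. c k * of_real ((norm (fh n (sq n + k)))\<^sup>2)) \<le> B * \<mu>\<^sup>2"
  proof -
    have "(\<integral>w. H w * cnj (f w) \<partial>?M)
        = (\<integral>w. (\<Sum>n\<in>?S. \<Sum>k\<in>?K. (c k * fh n (sq n + k)) * (mode d n (sq n + k) w * cnj (f w))) \<partial>?M)"
      unfolding H_def sum_distrib_right by (simp only: mult.assoc)
    also have "\<dots> = (\<Sum>n\<in>?S. \<Sum>k\<in>?K. (c k * fh n (sq n + k)) * cnj (fh n (sq n + k)))"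
      using int_f' by (simp add: cnj_fh)
    also have "\<dots> = (\<Sum>n\<in>?S. \<Sum>k\<in>?K. c k * of_real ((norm (fh n (sq n + k)))\<^sup>2))"
      by (simp only: complex_norm_square mult.assoc)
    finally have "norm (\<Sum>n\<in>?S. \<Sum>k\<in>?K. c k * of_real ((norm (fh n (sq n + k)))\<^sup>2)) = norm (\<integral>w. H w * cnj (f w) \<partial>?M)"
      by simp
    also have "\<dots> \<le> (\<integral>w. (B * \<mu>) * norm (f w) \<partial>?M)"
    proof (rule order_trans[OF Bochner_Integration.integral_norm_bound], rule Bochner_Integration.integral_mono')
      show "integrable ?M (\<lambda>w. B * \<mu> * norm (f w))"
        by (intro integrable_mult_right integrable_const_bound[where B = 1]) (auto simp: f1)
      show "norm (H w * cnj (f w)) \<le> B * \<mu> * norm (f w)" for w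
        unfolding norm_mult complex_mod_cnj using H by (intro mult_right_mono) auto
      have "0 \<le> B * \<mu>" using H[of undefined] norm_ge_zero order_trans by blast
      then show "0 \<le> B * \<mu> * norm (f w)" for w by simp
    qed
    also have "\<dots> = B * \<mu>\<^sup>2" using int_norm_f by (simp add: power2_eq_square)
    finally show ?thesis .
  qed

  \<comment> \<open>Distinct pairs \<open>(n, k)\<close> give distinct frequencies
    \<open>(n, sq n + k)\<close>, so no Fourier coefficient is counted twice.\<close>
  have bessel: "(\<Sum>n\<in>?S. \<Sum>k\<in>?K - {0}. (norm (fh n (sq n + k)))\<^sup>2) \<le> \<mu>"
  proof -
    have "(\<Sum>n\<in>?S. \<Sum>k\<in>?K - {0}. (norm (fh n (sq n + k)))\<^sup>2)
        = (\<Sum>i\<in>?S \<times> (?K - {0}). (norm (\<integral>z. f z * cnj (mode d (fst i) (sq (fst i) + snd i) z) \<partial>?M))\<^sup>2)"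
      by (simp add: sum.cartesian_product fh_def case_prod_unfold)
    also have "\<dots> \<le> (\<integral>z. (norm (f z))\<^sup>2 \<partial>?M)"
    proof (rule bessel_inequality[where B = 1])
      fix i j assume "i \<in> ?S \<times> (?K - {0})" "j \<in> ?S \<times> (?K - {0})"
      then show "(\<integral>z. mode d (fst i) (sq (fst i) + snd i) z * cnj (mode d (fst j) (sq (fst j) + snd j) z) \<partial>?M)
          = (if i = j then 1 else 0)"
        by (subst mode_orthonormal) (auto simp: prod_eq_iff)
    qed (auto simp: finite_freqs f1)
    finally show ?thesis unfolding int_norm_f2 .
  qed

  \<comment> \<open>Since \<open>c 0 = 1\<close>, the shift 0 contributes exactly
    \<open>G\<close>.\<close>
  have "complex_of_real G = (\<Sum>n\<in>?S. \<Sum>k\<in>?K. c k * of_real ((norm (fh n (sq n + k)))\<^sup>2))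
      - (\<Sum>n\<in>?S. \<Sum>k\<in>?K - {0}. c k * of_real ((norm (fh n (sq n + k)))\<^sup>2))"
  proof -
    have "(\<Sum>k\<in>?K. c k * of_real ((norm (fh n (sq n + k)))\<^sup>2))
        = of_real ((norm (fh n (sq n)))\<^sup>2) + (\<Sum>k\<in>?K - {0}. c k * of_real ((norm (fh n (sq n + k)))\<^sup>2))" for n
      by (subst sum.remove[of _ 0]) (auto simp: c0)
    then show ?thesis unfolding G_def by (simp add: sum.distrib)
  qed
  then have "norm (complex_of_real G) \<le> norm (\<Sum>n\<in>?S. \<Sum>k\<in>?K. c k * of_real ((norm (fh n (sq n + k)))\<^sup>2))
      + norm (\<Sum>n\<in>?S. \<Sum>k\<in>?K - {0}. c k * of_real ((norm (fh n (sq n + k)))\<^sup>2))"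
    by (simp only: norm_triangle_ineq4)
  moreover have "norm (\<Sum>n\<in>?S. \<Sum>k\<in>?K - {0}. c k * of_real ((norm (fh n (sq n + k)))\<^sup>2))
      \<le> (\<Sum>n\<in>?S. \<Sum>k\<in>?K - {0}. \<beta> * (norm (fh n (sq n + k)))\<^sup>2)"
  proof (intro sum_norm_le)
    fix n k assume "k \<in> ?K - {0}"
    then have "norm (c k) \<le> \<beta>" by (intro c\<beta>) auto
    then show "norm (c k * of_real ((norm (fh n (sq n + k)))\<^sup>2)) \<le> \<beta> * (norm (fh n (sq n + k)))\<^sup>2"
      by (simp add: norm_mult norm_power mult_right_mono)
  qed
  moreover have "(\<Sum>n\<in>?S. \<Sum>k\<in>?K - {0}. \<beta> * (norm (fh n (sq n + k)))\<^sup>2) \<le> \<beta> * \<mu>"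
    unfolding sum_distrib_left[symmetric] using bessel \<open>\<beta> \<ge> 0\<close> by (rule mult_left_mono)
  moreover have "G \<le> norm (complex_of_real G)" by simp
  ultimately show ?thesis using main dual by linarith
qed

text \<open>The factor 2 in the choice of \<open>\<alpha>\<^sup>2\<close> makes the quadratic error
  exactly half of the left side. It is absorbed, and dividing by the measure leaves the
  bound.\<close>

corollary level_set_measure_le:
  fixes N Q d :: nat and D :: real
  assumes "N \<ge> 1" "D \<ge> 8" "8 * ln Q \<le> D" "8 * real N * D \<le> real Q"
    and "2 * (real Q)\<^sup>2 * (2 * real N + 1) ^ d \<le> exp (4 * D\<^sup>2)"
    and a: "l2_norm d N a = 1" and \<alpha>: "\<alpha> > 0" "\<alpha>\<^sup>2 = 2 * D ^ (d + 4) * sqrt (real Q) ^ d"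
  shows "measure (torus_st d) {z \<in> space (torus_st d). \<alpha> < norm (schroedinger_sum d N a z)}
    \<le> 2 * D ^ (d + 4) / (real Q * \<alpha>\<^sup>2)"
proof -
  define \<mu> where "\<mu> = measure (torus_st d) {z \<in> space (torus_st d). \<alpha> < norm (schroedinger_sum d N a z)}"
  obtain L c \<Phi> where k: "c 0 = 1"
    "\<And>t. \<Phi> t = (\<Sum>k=-int L..int L. c k * ee (of_int k * t))"
    "\<And>k. k \<noteq> 0 \<Longrightarrow> \<bar>k\<bar> \<le> int L \<Longrightarrow> norm (c k) \<le> D ^ 4 / real Q"
    "\<And>t. \<exists>w\<ge>0. (\<forall>x. norm (weyl_sum N x t) \<le> w) \<and> norm (\<Phi> t) * w ^ d \<le> D ^ (d + 4) * sqrt (real Q) ^ d"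
    by (rule farey_kernel[OF assms(1-5)]) (erule that; assumption)
  have "0 < 8 * real N * D" using assms(1,2) by simp
  then have Q: "real Q > 0" using assms(4) by linarith
  have est: "\<alpha>\<^sup>2 * \<mu>\<^sup>2 \<le> D ^ (d + 4) * sqrt (real Q) ^ d * \<mu>\<^sup>2 + D ^ 4 / real Q * \<mu>"
    unfolding \<mu>_def by (rule level_set_estimate[OF k(1,2,3) _ k(4) a \<alpha>(1)]) (use assms(2) in auto)
  have "D ^ 4 \<le> D ^ (d + 4)" using assms(2) by (intro power_increasing) auto
  then have "D ^ 4 / real Q * \<mu> \<le> D ^ (d + 4) / real Q * \<mu>"
    using Q by (intro mult_right_mono divide_right_mono) (auto simp: \<mu>_def)
  moreover have "\<alpha>\<^sup>2 * \<mu>\<^sup>2 = \<alpha>\<^sup>2 / 2 * \<mu>\<^sup>2 + D ^ (d + 4) * sqrt (real Q) ^ d * \<mu>\<^sup>2"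
    unfolding \<alpha>(2) by simp
  ultimately have "\<alpha>\<^sup>2 / 2 * \<mu>\<^sup>2 \<le> D ^ (d + 4) / real Q * \<mu>" using est by linarith
  then have mul: "(\<alpha>\<^sup>2 / 2 * \<mu>) * \<mu> \<le> (D ^ (d + 4) / real Q) * \<mu>"
    by (simp add: power2_eq_square mult.assoc)
  have "\<alpha>\<^sup>2 / 2 * \<mu> \<le> D ^ (d + 4) / real Q"
  proof (cases "\<mu> = 0")
    case True
    then show ?thesis using assms(2) Q by simp
  next
    case False
    then have "\<mu> > 0" unfolding \<mu>_def by (simp add: zero_less_measure_iff)
    with mul show ?thesis by (rule mult_right_le_imp_le)
  qed
  then show ?thesis using \<alpha>(1) Q unfolding \<mu>_def[symmetric] by (simp add: field_simps)
qed

text \<open>Parseval's identity for the orthonormal modes on the paraboloid.\<close>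

lemma integral_norm_schroedinger_sum_square:
  "(\<integral>z. (norm (schroedinger_sum d N a z))\<^sup>2 \<partial>torus_st d) = (l2_norm d N a)\<^sup>2"
proof -
  interpret prob_space "torus_st d" by (rule prob_space_torus_st)
  let ?e = "\<lambda>n. mode d n (\<Sum>j<d. (n j)\<^sup>2)"
  have int: "integrable (torus_st d) (\<lambda>z. ?e n z * cnj (?e n' z))" for n n'
    by (rule integrable_const_bound[where B = 1]) (auto simp: norm_mult)
  have "complex_of_real (\<integral>z. (norm (schroedinger_sum d N a z))\<^sup>2 \<partial>torus_st d)
      = (\<integral>z. schroedinger_sum d N a z * cnj (schroedinger_sum d N a z) \<partial>torus_st d)"
    by (simp only: complex_norm_square[symmetric] integral_complex_of_real)
  also have "\<dots> = (\<integral>z. (\<Sum>n\<in>freqs d N. \<Sum>n'\<in>freqs d N. a n * cnj (a n') * (?e n z * cnj (?e n' z))) \<partial>torus_st d)"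
    unfolding schroedinger_sum_eq by (simp add: sum_product mult_ac)
  also have "\<dots> = (\<Sum>n\<in>freqs d N. \<Sum>n'\<in>freqs d N. a n * cnj (a n') * (\<integral>z. ?e n z * cnj (?e n' z) \<partial>torus_st d))"
    using int by simp
  also have "\<dots> = (\<Sum>n\<in>freqs d N. \<Sum>n'\<in>freqs d N. if n = n' then a n * cnj (a n) else 0)"
    by (intro sum.cong refl) (auto simp: mode_orthonormal)
  also have "\<dots> = (\<Sum>n\<in>freqs d N. of_real ((norm (a n))\<^sup>2))"
    by (simp add: finite_freqs complex_norm_square del: of_real_power)
  also have "\<dots> = of_real ((l2_norm d N a)\<^sup>2)"
    by (simp add: l2_norm_def sum_nonneg)
  finally show ?thesis by (simp only: of_real_eq_iff)
qed

text \<open>Cauchy-Schwarz over all frequencies of the box. It caps the levels that have to be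
  considered.\<close>

lemma norm_schroedinger_sum_square_le:
  "(norm (schroedinger_sum d N a z))\<^sup>2 \<le> (2 * real N + 1) ^ d * (l2_norm d N a)\<^sup>2"
proof -
  have "{n. \<bar>n\<bar> \<le> int N} = {-int N..int N}" by auto
  then have card: "real (card (freqs d N)) = (2 * real N + 1) ^ d"
    unfolding freqs_def by (simp add: card_PiE)
  have "(norm (schroedinger_sum d N a z))\<^sup>2 \<le> (\<Sum>n\<in>freqs d N. 1 * norm (a n))\<^sup>2"
    using norm_schroedinger_sum_le[of d N a z] by (intro power_mono) auto
  also have "\<dots> \<le> (\<Sum>n\<in>freqs d N. 1\<^sup>2) * (\<Sum>n\<in>freqs d N. (norm (a n))\<^sup>2)"
    by (rule Cauchy_Schwarz_ineq_sum)
  finally show ?thesis by (simp add: card l2_norm_def sum_nonneg)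
qed

section \<open>Summation over the levels\<close>

text \<open>A value up to \<open>\<alpha> 0\<close> is paid for by the quadratic term; a larger one
  lies in some step \<open>\<alpha> j < y \<le> \<alpha> (Suc j)\<close>, and that summand alone
  suffices.\<close>

lemma powr_le_sum_levels:
  fixes \<alpha> :: "nat \<Rightarrow> real" and y p :: real
  assumes "0 \<le> y" "y \<le> \<alpha> J" "2 \<le> p" "\<And>j. 0 < \<alpha> j"
  shows "y powr p \<le> \<alpha> 0 powr (p - 2) * y\<^sup>2 + (\<Sum>j<J. \<alpha> (Suc j) powr p * (if \<alpha> j < y then 1 else 0))"
proof (cases "y \<le> \<alpha> 0")
  case True
  have "y powr p = y powr (p - 2) * y\<^sup>2"
    using assms by (cases "y = 0") (auto simp: powr_diff)
  also have "\<dots> \<le> \<alpha> 0 powr (p - 2) * y\<^sup>2"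
    using True assms by (intro mult_right_mono powr_mono2) auto
  finally show ?thesis by (smt (verit) powr_ge_zero sum_nonneg mult_nonneg_nonneg)
next
  case False
  have "\<exists>j<J. \<alpha> j < y \<and> y \<le> \<alpha> (Suc j)"
    using assms(2)
  proof (induction J)
    case 0
    then show ?case using False by simp
  next
    case (Suc J)
    then show ?case by (cases "y \<le> \<alpha> J") (auto intro: less_SucI)
  qed
  then obtain j where j: "j < J" "\<alpha> j < y" "y \<le> \<alpha> (Suc j)" by blast
  have "y powr p \<le> \<alpha> (Suc j) powr p" using j assms by (intro powr_mono2) auto
  also have "\<dots> = \<alpha> (Suc j) powr p * (if \<alpha> j < y then 1 else 0)" using j by simp
  also have "\<dots> \<le> (\<Sum>j<J. \<alpha> (Suc j) powr p * (if \<alpha> j < y then 1 else 0))"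
    by (rule member_le_sum) (use j in auto)
  finally show ?thesis by (smt (verit) powr_ge_zero zero_le_power2 mult_nonneg_nonneg)
qed

text \<open>Integration of the pointwise inequality: the quadratic term has integral 1 by Parseval,
  and \<open>\<alpha> J\<close> lies above every value of the sum.\<close>

lemma integral_powr_le_sum_levels:
  fixes \<alpha> :: "nat \<Rightarrow> real" and p :: real
  assumes "l2_norm d N a = 1" "2 \<le> p" "\<And>j. 0 < \<alpha> j" "(2 * real N + 1) ^ d \<le> (\<alpha> J)\<^sup>2"
  shows "(\<integral>z. norm (schroedinger_sum d N a z) powr p \<partial>torus_st d) \<le> \<alpha> 0 powr (p - 2) +
    (\<Sum>j<J. \<alpha> (Suc j) powr p *
      measure (torus_st d) {z \<in> space (torus_st d). \<alpha> j < norm (schroedinger_sum d N a z)})"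
proof -
  interpret prob_space "torus_st d" by (rule prob_space_torus_st)
  let ?F = "\<lambda>z. norm (schroedinger_sum d N a z)"
  let ?E = "\<lambda>j. {z \<in> space (torus_st d). \<alpha> j < ?F z}"
  have FJ: "?F z \<le> \<alpha> J" for z
  proof (rule power2_le_imp_le)
    show "(?F z)\<^sup>2 \<le> (\<alpha> J)\<^sup>2"
      using norm_schroedinger_sum_square_le[of d N a z] assms(1,4) by simp
  qed (use assms(3)[of J] in simp)
  have int2: "integrable (torus_st d) (\<lambda>z. (?F z)\<^sup>2)"
    by (rule integrable_const_bound[where B = "(\<alpha> J)\<^sup>2"]) (auto intro!: power_mono FJ)
  define I where "I j = (indicator (?E j) :: _ \<Rightarrow> real)" for j
  have intI: "integrable (torus_st d) (I j)" for j
    unfolding I_def by (auto simp: less_top[symmetric])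
  have "(\<integral>z. ?F z powr p \<partial>torus_st d) \<le>
      (\<integral>z. \<alpha> 0 powr (p - 2) * (?F z)\<^sup>2 + (\<Sum>j<J. \<alpha> (Suc j) powr p * I j z) \<partial>torus_st d)"
  proof (rule integral_mono)
    show "integrable (torus_st d) (\<lambda>z. ?F z powr p)"
      using assms(2) by (intro integrable_schroedinger_sum) simp
    show "integrable (torus_st d) (\<lambda>z. \<alpha> 0 powr (p - 2) * (?F z)\<^sup>2 + (\<Sum>j<J. \<alpha> (Suc j) powr p * I j z))"
      by (intro Bochner_Integration.integrable_add Bochner_Integration.integrable_sum integrable_mult_right int2 intI)
    fix z assume z: "z \<in> space (torus_st d)"
    then have "I j z = (if \<alpha> j < ?F z then 1 else 0)" for j by (simp add: I_def indicator_def)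
    then show "?F z powr p \<le> \<alpha> 0 powr (p - 2) * (?F z)\<^sup>2 + (\<Sum>j<J. \<alpha> (Suc j) powr p * I j z)"
      using powr_le_sum_levels[of "?F z" \<alpha> J p] FJ assms by simp
  qed
  also have "\<dots> = \<alpha> 0 powr (p - 2) * (\<integral>z. (?F z)\<^sup>2 \<partial>torus_st d) + (\<Sum>j<J. \<alpha> (Suc j) powr p * (\<integral>z. I j z \<partial>torus_st d))"
    using int2 intI by simp
  also have "(\<lambda>j. \<integral>z. I j z \<partial>torus_st d) = (\<lambda>j. prob (?E j))"
    unfolding I_def by (simp add: Int_absorb2)
  finally show ?thesis
    unfolding integral_norm_schroedinger_sum_square assms(1) by simp
qed

section \<open>Exponents and the choice of scales\<close>

lemma exponent_gt_2:
  fixes p :: real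
  assumes "d \<ge> 1" "p > 2 * (real d + 4) / real d"
  shows "p > 2"
proof -
  have "2 * (real d + 4) / real d = 2 + 8 / real d" "8 / real d > 0"
    using assms(1) by (simp_all add: field_simps)
  then show ?thesis using assms(2) by linarith
qed

text \<open>\<open>Q\<close> and \<open>Q'\<close> are the denominator scales of consecutive levels.
  Up to factors in \<open>D\<close> and \<open>T\<close> a level costs \<open>Q powr s\<close> with
  a nonnegative \<open>s\<close>, so the worst scale is \<open>Q = N\<^sup>2\<close>, which gives
  the target power of \<open>N\<close>.\<close>

lemma level_terms_le:
  fixes N Q Q' D T p :: real and d :: nat
  assumes d: "d \<ge> 1" and p: "p > 2 * (real d + 4) / real d" and N: "N \<ge> 1" and D: "D \<ge> 1" and T: "T > 0"
    and Q: "0 < Q" "Q \<le> 16 * N\<^sup>2" "Q' \<le> 2 * D * Q" "0 < Q'"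
    and \<alpha>: "0 < \<alpha>" "0 < \<alpha>'" "\<alpha>\<^sup>2 = T * sqrt Q ^ d" "\<alpha>'\<^sup>2 = T * sqrt Q' ^ d"
  shows "\<alpha>' powr p * (T / (Q * \<alpha>\<^sup>2)) \<le>
    (2 * D) powr (real d * p / 4) * T powr (p / 2) * 16 powr (real d * p) * N powr (real d * p / 2 - real d - 2)"
    and "Q \<le> 16 * N * D \<Longrightarrow> \<alpha> powr (p - 2) \<le>
      T powr ((p - 2) / 2) * D powr (real d * p / 4) * 16 powr (real d * p) * N powr (real d * p / 2 - real d - 2)"
proof -
  have dp: "real d * p > 2 * real d + 8" using d p by (simp add: field_simps)
  have sq: "sqrt x ^ d = x powr (real d / 2)" if "x > 0" for x
    using that by (simp add: powr_half_sqrt[symmetric] powr_realpow[symmetric] powr_powr)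
  have pw: "x powr q = (x\<^sup>2) powr (q / 2)" if "x > 0" for x q :: real
    using that by (simp add: powr_powr flip: powr_numeral)
  \<comment> \<open>Twice \<open>s\<close> is the target exponent. The lower bound on
    \<open>p\<close> is what gives \<open>s + 1 \<le> 2 * s\<close>, that is,
    \<open>d * (p - 2) \<ge> 8\<close>; so the part below the first level, about
    \<open>N powr (s + 1)\<close>, stays within the target.\<close>
  define s where "s = real d * (p - 2) / 4 - 1"
  have "s = real d * p / 4 - real d / 2 - 1" unfolding s_def by (simp add: field_simps)
  then have s: "s \<ge> 0" "s \<le> real d * p" "s + 1 \<le> 2 * s" "real d * p / 2 - real d - 2 = 2 * s"
    "s + 1 \<le> real d * p" "s + 1 \<le> real d * p / 4"
    using dp by linarith+
  have sd: "s + 1 = real d / 2 * (p / 2 - 1)" unfolding s_def by (simp add: field_simps)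
  have p2: "p > 2" using d p by (rule exponent_gt_2)
  have \<alpha>2: "\<alpha>\<^sup>2 = T * Q powr (real d / 2)" using \<alpha> Q sq by simp
  have "\<alpha>'\<^sup>2 \<le> T * (2 * D * Q) powr (real d / 2)"
    using \<alpha> Q T sq by (simp add: powr_mono2)
  also have "\<dots> = (2 * D) powr (real d / 2) * \<alpha>\<^sup>2"
    unfolding \<alpha>2 using Q D by (simp add: powr_mult)
  finally have "(\<alpha>'\<^sup>2) powr (p / 2) \<le> ((2 * D) powr (real d / 2) * \<alpha>\<^sup>2) powr (p / 2)"
    using p2 by (intro powr_mono2) auto
  also have "\<dots> = (2 * D) powr (real d * p / 4) * (\<alpha>\<^sup>2) powr (p / 2)"
    using D by (simp add: powr_mult powr_powr)
  finally have "\<alpha>' powr p * (T / (Q * \<alpha>\<^sup>2)) \<le> (2 * D) powr (real d * p / 4) * (\<alpha>\<^sup>2) powr (p / 2) * (T / (Q * \<alpha>\<^sup>2))"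
    unfolding pw[OF \<alpha>(2), of p] using T Q by (intro mult_right_mono) auto
  then have "\<alpha>' powr p * (T / (Q * \<alpha>\<^sup>2)) \<le> (2 * D) powr (real d * p / 4) * ((\<alpha>\<^sup>2) powr (p / 2) * (T / (Q * \<alpha>\<^sup>2)))"
    by (simp only: mult.assoc)
  moreover have "(\<alpha>\<^sup>2) powr (p / 2) * (T / (Q * \<alpha>\<^sup>2)) = T powr (p / 2) * Q powr s"
  proof -
    have "(\<alpha>\<^sup>2) powr (p / 2) = (\<alpha>\<^sup>2) powr (p / 2 - 1) * \<alpha>\<^sup>2"
      using \<alpha>(1) by (simp add: powr_diff)
    then have "(\<alpha>\<^sup>2) powr (p / 2) * (T / (Q * \<alpha>\<^sup>2)) = T * (\<alpha>\<^sup>2) powr (p / 2 - 1) / Q"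
      using \<alpha>(1) Q by simp
    also have "(\<alpha>\<^sup>2) powr (p / 2 - 1) = T powr (p / 2 - 1) * Q powr (s + 1)"
      unfolding \<alpha>2 sd using T Q by (simp add: powr_mult powr_powr)
    also have "T * (T powr (p / 2 - 1) * Q powr (s + 1)) / Q = (T * T powr (p / 2 - 1)) * (Q powr (s + 1) / Q)"
      by simp
    also have "\<dots> = T powr (p / 2) * Q powr s"
      using T Q by (simp add: powr_mult_base powr_add)
    finally show ?thesis .
  qed
  moreover have "Q powr s \<le> 16 powr (real d * p) * N powr (2 * s)"
  proof -
    have "Q powr s \<le> (16 * N\<^sup>2) powr s" using Q s by (intro powr_mono2) auto
    also have "\<dots> = 16 powr s * N powr (2 * s)"
      using N by (simp add: powr_mult powr_powr flip: powr_numeral)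
    also have "\<dots> \<le> 16 powr (real d * p) * N powr (2 * s)"
      using s by (intro mult_right_mono powr_mono) auto
    finally show ?thesis .
  qed
  then have "(2 * D) powr (real d * p / 4) * (T powr (p / 2) * Q powr s)
      \<le> (2 * D) powr (real d * p / 4) * (T powr (p / 2) * (16 powr (real d * p) * N powr (2 * s)))"
    by (intro mult_left_mono) auto
  ultimately show "\<alpha>' powr p * (T / (Q * \<alpha>\<^sup>2)) \<le>
    (2 * D) powr (real d * p / 4) * T powr (p / 2) * 16 powr (real d * p) * N powr (real d * p / 2 - real d - 2)"
    unfolding s(4) by (simp only: mult.assoc)
  assume Q16: "Q \<le> 16 * N * D"
  have "\<alpha> powr (p - 2) = T powr ((p - 2) / 2) * Q powr (s + 1)"
    unfolding pw[OF \<alpha>(1), of "p - 2"] \<alpha>2 sd using T Q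
    by (simp add: powr_mult powr_powr diff_divide_distrib)
  moreover have "Q powr (s + 1) \<le> 16 powr (real d * p) * N powr (2 * s) * D powr (real d * p / 4)"
  proof -
    have "Q powr (s + 1) \<le> (16 * N * D) powr (s + 1)" using Q16 Q s by (intro powr_mono2) auto
    also have "\<dots> = 16 powr (s + 1) * N powr (s + 1) * D powr (s + 1)" using N D by (simp add: powr_mult)
    also have "\<dots> \<le> 16 powr (real d * p) * N powr (2 * s) * D powr (real d * p / 4)"
      using N D s by (intro mult_mono powr_mono) auto
    finally show ?thesis .
  qed
  then have "T powr ((p - 2) / 2) * Q powr (s + 1)
      \<le> T powr ((p - 2) / 2) * (16 powr (real d * p) * N powr (2 * s) * D powr (real d * p / 4))"
    by (intro mult_left_mono) auto
  ultimately show "\<alpha> powr (p - 2) \<le>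
      T powr ((p - 2) / 2) * D powr (real d * p / 4) * 16 powr (real d * p) * N powr (real d * p / 2 - real d - 2)"
    unfolding s(4) by (simp only: mult_ac)
qed

text \<open>The part below the first level and each of the \<open>m - 1\<close> steps between levels
  cost at most \<open>?R\<close>, which adds up to \<open>m\<close> copies.\<close>

lemma integral_powr_schroedinger_sum_le:
  fixes d m N :: nat and p D :: real
  assumes d: "d \<ge> 1" and p: "p > 2 * (real d + 4) / real d" and m: "m \<ge> 1" and N: "N \<ge> 1"
    and D: "D \<ge> 8" "D ^ m = real N" "8 * ln (16 * (real N)\<^sup>2) \<le> D"
    and far: "2 * (16 * (real N)\<^sup>2)\<^sup>2 * (2 * real N + 1) ^ d \<le> exp (4 * D\<^sup>2)"
    and a: "l2_norm d N a = 1"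
  shows "(\<integral>z. norm (schroedinger_sum d N a z) powr p \<partial>torus_st d) \<le>
    real m * ((2 * D) powr (real d * p / 4) * (2 * D ^ (d + 4)) powr (p / 2) * 16 powr (real d * p) *
      real N powr (real d * p / 2 - real d - 2))"
    (is "_ \<le> real m * ?R")
proof -
  have p2: "p > 2" using d p by (rule exponent_gt_2)
  define T where "T = 2 * D ^ (d + 4)"
  \<comment> \<open>Since \<open>D\<close> is the \<open>m\<close>-th root of \<open>N\<close>, the geometric progression \<open>Q\<close> covers the range from \<open>N\<close> to
    \<open>N\<^sup>2\<close> in \<open>m\<close> steps, independently of \<open>N\<close>.\<close>
  define Q where "Q j = nat \<lceil>8 * real N * D ^ (j + 1)\<rceil>" for j
  define \<alpha> where "\<alpha> j = sqrt (T * sqrt (real (Q j)) ^ d)" for j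
  define \<mu> where "\<mu> j = measure (torus_st d) {z \<in> space (torus_st d). \<alpha> j < norm (schroedinger_sum d N a z)}" for j
  have Dpow: "1 \<le> D ^ k" for k using D(1) by (intro one_le_power) auto
  have T: "T \<ge> 1" using Dpow[of "d + 4"] unfolding T_def by simp
  have ND: "8 * 1 * 1 \<le> 8 * real N * D ^ (j + 1)" for j
    using N Dpow[of "j + 1"] by (intro mult_mono) auto
  have Q_ge: "8 * real N * D ^ (j + 1) \<le> real (Q j)" for j
    unfolding Q_def by (rule real_nat_ceiling_ge)
  have Q_le: "real (Q j) \<le> 16 * real N * D ^ (j + 1)" for j
    using ND[of j] unfolding Q_def by linarith
  have Q0: "0 < real (Q j)" for j using Q_ge[of j] ND[of j] by linarith
  have Q_step: "real (Q (Suc j)) \<le> 2 * D * real (Q j)" for j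
  proof -
    have "real (Q (Suc j)) \<le> 2 * D * (8 * real N * D ^ (j + 1))" using Q_le[of "Suc j"] by (simp add: mult_ac)
    also have "\<dots> \<le> 2 * D * real (Q j)" using Q_ge D by (intro mult_left_mono) auto
    finally show ?thesis .
  qed
  have Q_N: "real (Q j) \<le> 16 * (real N)\<^sup>2" if "j < m" for j
  proof -
    have "D ^ (j + 1) \<le> D ^ m" using that D by (intro power_increasing) auto
    then have "16 * real N * D ^ (j + 1) \<le> 16 * real N * real N"
      unfolding D(2) by (intro mult_left_mono) auto
    then show ?thesis using Q_le[of j] by (simp add: power2_eq_square)
  qed
  have \<alpha>0: "0 < \<alpha> j" for j unfolding \<alpha>_def using T Q0[of j] by simp
  have \<alpha>2: "(\<alpha> j)\<^sup>2 = T * sqrt (real (Q j)) ^ d" for j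
    unfolding \<alpha>_def using T by simp
  have \<mu>: "\<mu> j \<le> T / (real (Q j) * (\<alpha> j)\<^sup>2)" if j: "j < m" for j
    unfolding \<mu>_def T_def
  proof (rule level_set_measure_le)
    have "ln (real (Q j)) \<le> ln (16 * (real N)\<^sup>2)"
      using Q_N[OF j] Q0[of j] N by (subst ln_le_cancel_iff) auto
    then show "8 * ln (real (Q j)) \<le> D" using D(3) by linarith
    have "8 * real N * D ^ 1 \<le> 8 * real N * D ^ (j + 1)"
      using D by (intro mult_left_mono power_increasing) auto
    then show "8 * real N * D \<le> real (Q j)" using Q_ge[of j] by simp
    have "2 * (real (Q j))\<^sup>2 * (2 * real N + 1) ^ d \<le> 2 * (16 * (real N)\<^sup>2)\<^sup>2 * (2 * real N + 1) ^ d"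
      using Q_N[OF j] by (intro mult_right_mono mult_left_mono power_mono) auto
    then show "2 * (real (Q j))\<^sup>2 * (2 * real N + 1) ^ d \<le> exp (4 * D\<^sup>2)" using far by linarith
    show "(\<alpha> j)\<^sup>2 = 2 * D ^ (d + 4) * sqrt (real (Q j)) ^ d" using \<alpha>2[of j] unfolding T_def .
  qed (use N D a \<alpha>0 in auto)
  \<comment> \<open>The last scale satisfies \<open>Q (m - 1) \<ge> 8 * N\<^sup>2\<close>, so its
    level already exceeds the trivial bound for the sum.\<close>
  have top: "(2 * real N + 1) ^ d \<le> (\<alpha> (m - 1))\<^sup>2"
  proof -
    have "(real N)\<^sup>2 \<le> 8 * real N * D ^ m" unfolding D(2) by (simp add: power2_eq_square)
    also have "\<dots> \<le> real (Q (m - 1))" using Q_ge[of "m - 1"] m by simp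
    finally have sN: "real N \<le> sqrt (real (Q (m - 1)))" by (rule real_le_rsqrt)
    have "(2 * real N + 1) ^ d \<le> (D * real N) ^ d"
    proof (rule power_mono)
      have "8 * real N \<le> D * real N" using D by (intro mult_right_mono) auto
      then show "2 * real N + 1 \<le> D * real N" using N by linarith
    qed simp
    also have "\<dots> = D ^ d * real N ^ d" by (rule power_mult_distrib)
    also have "\<dots> \<le> T * sqrt (real (Q (m - 1))) ^ d"
    proof (intro mult_mono power_mono sN)
      have "D ^ d \<le> D ^ (d + 4)" using D by (intro power_increasing) auto
      then show "D ^ d \<le> T" using Dpow[of "d + 4"] unfolding T_def by linarith
    qed (use T in auto)
    finally show ?thesis unfolding \<alpha>2 .
  qed
  have level: "\<alpha> (Suc j) powr p * \<mu> j \<le> ?R" if "j < m - 1" for j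
  proof -
    have "\<alpha> (Suc j) powr p * \<mu> j \<le> \<alpha> (Suc j) powr p * (T / (real (Q j) * (\<alpha> j)\<^sup>2))"
      using \<mu>[of j] that by (intro mult_left_mono) auto
    also have "\<dots> \<le> ?R"
      unfolding T_def[symmetric]
      by (rule level_terms_le(1)[OF d p _ _ _ Q0 _ Q_step Q0 \<alpha>0 \<alpha>0 \<alpha>2 \<alpha>2])
         (use N D T Q_N[of j] that in auto)
    finally show ?thesis .
  qed
  \<comment> \<open>The first scale is at most \<open>16 * N * D\<close>, so the second estimate for
    level terms applies.\<close>
  have first: "\<alpha> 0 powr (p - 2) \<le> ?R"
  proof -
    have "\<alpha> 0 powr (p - 2) \<le> T powr ((p - 2) / 2) * D powr (real d * p / 4) * 16 powr (real d * p) *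
        real N powr (real d * p / 2 - real d - 2)"
      by (rule level_terms_le(2)[OF d p _ _ _ Q0 _ Q_step Q0 \<alpha>0 \<alpha>0 \<alpha>2 \<alpha>2])
         (use N D T Q_N[of 0] Q_le[of 0] m in auto)
    also have "\<dots> \<le> (T powr (p / 2) * (2 * D) powr (real d * p / 4)) * 16 powr (real d * p) *
        real N powr (real d * p / 2 - real d - 2)"
      using T D p2 d by (intro mult_right_mono mult_mono powr_mono powr_mono2) auto
    finally show ?thesis unfolding T_def by (simp only: mult_ac)
  qed
  have "(\<integral>z. norm (schroedinger_sum d N a z) powr p \<partial>torus_st d) \<le>
      \<alpha> 0 powr (p - 2) + (\<Sum>j<m - 1. \<alpha> (Suc j) powr p * \<mu> j)"
    unfolding \<mu>_def using a p2 \<alpha>0 top by (intro integral_powr_le_sum_levels) auto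
  also have "\<dots> \<le> ?R + (\<Sum>j<m - 1. ?R)"
    using first level by (intro add_mono sum_mono) auto
  also have "\<dots> = real m * ?R" using m by (simp add: of_nat_diff algebra_simps)
  finally show ?thesis .
qed

section \<open>Passage to arbitrary coefficients and all \<open>N\<close>\<close>

text \<open>Both sides are homogeneous in the coefficients; the zero vector, which cannot be
  normalised, is treated apart.\<close>

lemma Lp_norm_le_by_normalization:
  assumes p: "p > 0" and "K \<ge> 0"
    and unit: "\<And>b. l2_norm d N b = 1 \<Longrightarrow> (\<integral>z. norm (schroedinger_sum d N b z) powr p \<partial>torus_st d) \<le> K powr p"
  shows "Lp_norm (torus_st d) p (schroedinger_sum d N a) \<le> K * l2_norm d N a"
proof (cases "l2_norm d N a = 0")
  case True
  have "(\<Sum>n\<in>freqs d N. norm (a n)) \<le> 0"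
    using norm_le_l2_norm[of _ d N a] True by (intro sum_nonpos) simp
  then show ?thesis using Lp_norm_schroedinger_sum_le[OF p, of d N a] True by simp
next
  case False
  define r where "r = l2_norm d N a"
  have r: "r > 0" using False unfolding r_def l2_norm_def by (simp add: sum_nonneg order_less_le)
  define b where "b n = a n / of_real r" for n
  have "(\<Sum>n\<in>freqs d N. (norm (b n))\<^sup>2) = (\<Sum>n\<in>freqs d N. (norm (a n))\<^sup>2) / r\<^sup>2"
    unfolding b_def using r by (simp add: norm_divide power_divide sum_divide_distrib)
  also have "(\<Sum>n\<in>freqs d N. (norm (a n))\<^sup>2) = r\<^sup>2"
    unfolding r_def l2_norm_def by (simp add: sum_nonneg)
  finally have b: "l2_norm d N b = 1" unfolding l2_norm_def using r by simp
  have "schroedinger_sum d N a z = of_real r * schroedinger_sum d N b z" for z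
    unfolding schroedinger_sum_eq b_def sum_distrib_left using r by simp
  then have "norm (schroedinger_sum d N a z) powr p = r powr p * norm (schroedinger_sum d N b z) powr p" for z
    using r by (simp add: norm_mult powr_mult)
  then have "(\<integral>z. norm (schroedinger_sum d N a z) powr p \<partial>torus_st d)
      = r powr p * (\<integral>z. norm (schroedinger_sum d N b z) powr p \<partial>torus_st d)" by simp
  also have "\<dots> \<le> r powr p * K powr p" using unit[OF b] by (intro mult_left_mono) auto
  also have "\<dots> = (K * r) powr p" using r \<open>K \<ge> 0\<close> by (simp add: powr_mult mult.commute)
  finally have "Lp_norm (torus_st d) p (schroedinger_sum d N a) \<le> ((K * r) powr p) powr (1 / p)"
    unfolding Lp_norm_def using p by (intro powr_mono2) auto
  then show ?thesis using p r \<open>K \<ge> 0\<close> unfolding r_def by (simp add: powr_powr)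
qed

text \<open>A fixed positive power of \<open>N\<close> outgrows every multiple of
  \<open>ln N\<close>, and the third condition is of this kind after taking logarithms.\<close>

lemma eventually_scales_admissible:
  fixes d m :: nat
  assumes "d \<ge> 1" "m \<ge> 1"
  shows "eventually (\<lambda>N. real N powr (1 / m) \<ge> 8 \<and> 8 * ln (16 * (real N)\<^sup>2) \<le> real N powr (1 / m) \<and>
    2 * (16 * (real N)\<^sup>2)\<^sup>2 * (2 * real N + 1) ^ d \<le> exp (4 * (real N powr (1 / m))\<^sup>2)) sequentially"
proof -
  define \<delta> where "\<delta> = 1 / real m"
  define k where "k = real d"
  have pos: "\<delta> > 0" "k > 0" using assms unfolding \<delta>_def k_def by auto
  have "eventually (\<lambda>N::nat. real N powr \<delta> \<ge> 8) sequentially"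
    using pos by real_asymp
  moreover have "eventually (\<lambda>N::nat. 8 * ln (16 * (real N)\<^sup>2) \<le> real N powr \<delta>) sequentially"
    using pos by real_asymp
  moreover have "eventually (\<lambda>N::nat. ln (2 * (16 * (real N)\<^sup>2)\<^sup>2) + k * ln (2 * real N + 1) \<le> 4 * (real N powr \<delta>)\<^sup>2) sequentially"
    using pos by real_asymp
  moreover have "eventually (\<lambda>N::nat. N \<ge> 1) sequentially" by (rule eventually_ge_at_top)
  ultimately show ?thesis
  proof eventually_elim
    case (elim N)
    have "2 * (16 * (real N)\<^sup>2)\<^sup>2 * (2 * real N + 1) ^ d
        = exp (ln (2 * (16 * (real N)\<^sup>2)\<^sup>2) + k * ln (2 * real N + 1))"
      using elim unfolding k_def by (simp add: exp_add exp_of_nat_mult)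
    also have "\<dots> \<le> exp (4 * (real N powr \<delta>)\<^sup>2)" using elim by simp
    finally show ?case using elim unfolding \<delta>_def by simp
  qed
qed

theorem corollary1p2:
  fixes d :: nat and p \<epsilon> :: real
  assumes "d \<ge> 1" and "p > 2 * (real d + 4) / real d" and "\<epsilon> > 0"
  shows "\<exists>C::real. \<forall>N::nat. N \<ge> 1 \<longrightarrow>
    strichartz_const p d N \<le> C * real N powr (real d / 2 - (real d + 2) / p + \<epsilon>)"
proof -
  let ?g = "\<lambda>N. real N powr (real d / 2 - (real d + 2) / p + \<epsilon>)"
  \<comment> \<open>In the bound for the integral, \<open>D\<close> occurs to the power
    \<open>e * p\<close>; its \<open>p\<close>-th root is \<open>D powr e\<close>, that is,
    \<open>N powr (e / m)\<close>. Hence \<open>m\<close> is chosen below with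
    \<open>e / m \<le> \<epsilon>\<close>.\<close>
  define e where "e = real d / 4 + (real d + 4) / 2"
  have p0: "p > 0" using exponent_gt_2[OF assms(1,2)] by simp
  obtain m :: nat where "e / \<epsilon> \<le> real m" using real_arch_simple by blast
  moreover have "e / \<epsilon> > 0"
    using assms(3) unfolding e_def by (intro divide_pos_pos add_nonneg_pos) auto
  ultimately have "real m > 0" "e \<le> real m * \<epsilon>"
    using assms(3) by (linarith, simp add: pos_divide_le_eq)
  then have m: "m \<ge> 1" "e / real m \<le> \<epsilon>"
    by (auto simp: pos_divide_le_eq mult.commute)
  \<comment> \<open>The factors of the integral bound that do not depend on
    \<open>N\<close>.\<close>
  define A where "A = real m * (2 powr (real d * p / 4) * 2 powr (p / 2) * 16 powr (real d * p))"
  define C where "C = A powr (1 / p)"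
  have A: "A > 0" using m(1) unfolding A_def by simp
  have large: "strichartz_const p d N \<le> C * ?g N"
    if N: "N \<ge> 1" and D: "real N powr (1 / m) \<ge> 8" "8 * ln (16 * (real N)\<^sup>2) \<le> real N powr (1 / m)"
      "2 * (16 * (real N)\<^sup>2)\<^sup>2 * (2 * real N + 1) ^ d \<le> exp (4 * (real N powr (1 / m))\<^sup>2)" for N
  proof (rule strichartz_const_least, rule allI, rule Lp_norm_le_by_normalization[OF p0])
    show "0 \<le> C * ?g N" unfolding C_def by simp
    fix b assume b: "l2_norm d N b = 1"
    define D where "D = real N powr (1 / m)"
    have D0: "D > 0" using N unfolding D_def by simp
    have Dm: "D ^ m = real N"
      using N m unfolding D_def by (simp add: powr_realpow[symmetric] powr_powr)
    have "(\<integral>z. norm (schroedinger_sum d N b z) powr p \<partial>torus_st d) \<le>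
      real m * ((2 * D) powr (real d * p / 4) * (2 * D ^ (d + 4)) powr (p / 2) * 16 powr (real d * p) *
        real N powr (real d * p / 2 - real d - 2))"
      using D unfolding D_def[symmetric]
      by (intro integral_powr_schroedinger_sum_le assms m N Dm b)
    also have "\<dots> = A * (D powr (e * p) * real N powr (real d * p / 2 - real d - 2))"
    proof -
      have "(2 * D ^ (d + 4)) powr (p / 2) = 2 powr (p / 2) * D powr ((real d + 4) * p / 2)"
        using D0 by (simp add: powr_mult powr_powr flip: powr_realpow)
      moreover have "(2 * D) powr (real d * p / 4) = 2 powr (real d * p / 4) * D powr (real d * p / 4)"
        using D0 by (simp add: powr_mult)
      moreover have "D powr (e * p) = D powr (real d * p / 4) * D powr ((real d + 4) * p / 2)"
        unfolding e_def powr_add[symmetric] by (simp add: field_simps)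
      ultimately show ?thesis unfolding A_def by simp
    qed
    also have "D powr (e * p) * real N powr (real d * p / 2 - real d - 2)
        = real N powr (e / m * p + (real d * p / 2 - real d - 2))"
      unfolding D_def powr_powr powr_add by simp
    also have "A * \<dots> \<le> A * real N powr ((real d / 2 - (real d + 2) / p + \<epsilon>) * p)"
    proof (intro mult_left_mono powr_mono)
      have "e / m * p \<le> \<epsilon> * p" using m p0 by (intro mult_right_mono) auto
      moreover have "(real d / 2 - (real d + 2) / p + \<epsilon>) * p = real d * p / 2 - real d - 2 + \<epsilon> * p"
        using p0 by (simp add: field_simps)
      ultimately show "e / m * p + (real d * p / 2 - real d - 2) \<le> (real d / 2 - (real d + 2) / p + \<epsilon>) * p"
        by linarith
    qed (use A N in auto)
    also have "\<dots> = (C * ?g N) powr p"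
      unfolding C_def using A p0 by (simp add: powr_mult powr_powr)
    finally show "(\<integral>z. norm (schroedinger_sum d N b z) powr p \<partial>torus_st d) \<le> (C * ?g N) powr p" .
  qed
  obtain N0 where N0: "\<And>N. N \<ge> N0 \<Longrightarrow> N \<ge> 1 \<Longrightarrow> strichartz_const p d N \<le> C * ?g N"
    using eventually_scales_admissible[OF assms(1) m(1)] large unfolding eventually_sequentially by blast
  \<comment> \<open>The finitely many \<open>N\<close> below \<open>N0\<close> are covered by the
    sum of their ratios to the claimed power.\<close>
  define C' where "C' = (\<Sum>N\<in>{1..N0}. \<bar>strichartz_const p d N\<bar> / ?g N)"
  show ?thesis
  proof (intro exI[of _ "C + C'"] allI impI)
    fix N :: nat assume N: "N \<ge> 1"
    then have g: "?g N > 0" by simp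
    have C': "C' \<ge> 0" "C \<ge> 0" unfolding C'_def C_def by (auto intro!: sum_nonneg)
    show "strichartz_const p d N \<le> (C + C') * ?g N"
    proof (cases "N \<ge> N0")
      case True
      then have "strichartz_const p d N \<le> C * ?g N" using N0 N by blast
      also have "\<dots> \<le> (C + C') * ?g N" using C' by (intro mult_right_mono) auto
      finally show ?thesis .
    next
      case False
      then have "\<bar>strichartz_const p d N\<bar> / ?g N \<le> C'"
        unfolding C'_def using N by (intro member_le_sum) auto
      then have "\<bar>strichartz_const p d N\<bar> \<le> C' * ?g N" using g by (simp add: pos_divide_le_eq)
      also have "\<dots> \<le> (C + C') * ?g N" using C' by (intro mult_right_mono) auto
      finally show ?thesis by simp
    qed
  qed
qed

end
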